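(* For every $d,N \in \mathbb{N}$ with $d \geq 2$, every $r \in [1,d)$ and every $s< \infty$ there is a divergence-free vector field $u \in C((0,1); W^{1,r}(\mathbb{T}^d; \mathbb{R}^d) \cap L^s(\mathbb{T}^d;\mathbb{R}^d))$ such that the following holds for every Borel map $v:(0,1)\times\mathbb{T}^d\to\mathbb{R}^d$ with $u = v$ $\mathscr{L}^{d+1}$-a.e.: for $\mathscr{L}^d$-a.e. $x \in \mathbb{T}^d$ there are at least $N$ integral curves of $v$ starting at $x$.
   Context: $\mathbb{T}^d=\mathbb{R}^d/\mathbb{Z}^d$ is the $d$-dimensional torus. $\mathscr{L}^d$ denotes Lebesgue measure on $\mathbb{T}^d$ and $\mathscr{L}^{d+1}$ Lebesgue measure on $(0,1)\times\mathbb{T}^d$. Divergence-free means that the spatial divergence vanishes in the sense of distributions. Definition (integral curve). Let $v: (0,1) \times \mathbb{T}^d \to \mathbb{R}^d$ be a Borel map. An absolutely continuous curve $\gamma \in AC([0,1]; \mathbb{T}^d)$ is an integral curve of $v$ starting at $x$ if $\gamma(0)=x$ and $\gamma'(t) = v(t, \gamma(t))$ for a.e. $t\in (0,1)$. *)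

theory Defs
  imports "HOL-Analysis.Analysis"
begin

text \<open>
  The torus \<open>\<real>\<^sup>d / \<int>\<^sup>d\<close> is handled through its universal cover \<open>real ^ 'd\<close>, where \<open>d = CARD('d)\<close>:
  a point is a vector up to \<open>torus_eq\<close>, a function on the torus is a \<open>\<int>\<^sup>d\<close>-periodic function on
  \<open>real ^ 'd\<close>, and Lebesgue measure on the torus is Lebesgue measure on the fundamental cell
  \<open>[0,1)\<^sup>d\<close>. A function on the torus is Borel if and only if its periodic lift is.
\<close>

definition int_lattice :: "(real ^ 'd) set" where
  "int_lattice = {k. \<forall>i. k $ i \<in> \<int>}"

definition torus_eq :: "real ^ 'd \<Rightarrow> real ^ 'd \<Rightarrow> bool" where
  "torus_eq x y \<longleftrightarrow> x - y \<in> int_lattice"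

definition periodic :: "(real ^ 'd \<Rightarrow> 'b) \<Rightarrow> bool" where
  "periodic f \<longleftrightarrow> (\<forall>x. \<forall>k\<in>int_lattice. f (x + k) = f x)"

definition cell :: "(real ^ 'd) set" where
  "cell = {x. \<forall>i. 0 \<le> x $ i \<and> x $ i < 1}"

definition torus_measure :: "(real ^ 'd) measure" where
  "torus_measure = restrict_space lborel cell"

definition spacetime_measure :: "(real \<times> (real ^ 'd)) measure" where
  "spacetime_measure = restrict_space lborel ({0<..<1} \<times> cell)"

text \<open>Borel maps from \<open>(0,1) \<times> \<real>\<^sup>d/\<int>\<^sup>d\<close> to \<open>\<real>\<^sup>d\<close>; values at times outside \<open>(0,1)\<close> are irrelevant.\<close>

definition borel_field :: "(real \<times> (real ^ 'd) \<Rightarrow> real ^ 'd) \<Rightarrow> bool" where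
  "borel_field v \<longleftrightarrow>
     v \<in> borel_measurable (restrict_space borel ({0<..<1} \<times> UNIV)) \<and>
     (\<forall>t\<in>{0<..<1}. periodic (\<lambda>x. v (t, x)))"


subsection \<open>Smooth functions\<close>

definition partial :: "'d \<Rightarrow> (real ^ 'd \<Rightarrow> real) \<Rightarrow> real ^ 'd \<Rightarrow> real" where
  "partial j \<phi> x = frechet_derivative \<phi> (at x) (axis j 1)"

text \<open>\<open>C\<^sup>\<infinity>\<close>: all iterated partial derivatives (indexed by lists of directions) exist and are
  differentiable, hence also continuous.\<close>

definition smooth :: "(real ^ 'd \<Rightarrow> real) \<Rightarrow> bool" where
  "smooth \<phi> \<longleftrightarrow> (\<forall>js. fold partial js \<phi> differentiable_on UNIV)"

definition test_function :: "(real ^ 'd \<Rightarrow> real) \<Rightarrow> bool" where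
  "test_function \<phi> \<longleftrightarrow> smooth \<phi> \<and> periodic \<phi>"


subsection \<open>Lebesgue and Sobolev spaces on the torus\<close>

text \<open>
  Elements are periodic Borel functions rather than classes modulo null sets. For \<open>p < 1\<close> the
  functional \<open>Lp_norm p\<close> is the usual quasi-norm.
\<close>

definition Lp :: "real \<Rightarrow> (real ^ 'd \<Rightarrow> 'b::euclidean_space) set" where
  "Lp p = {f \<in> borel_measurable borel. periodic f \<and>
                integrable torus_measure (\<lambda>x. norm (f x) powr p)}"

definition Lp_norm :: "real \<Rightarrow> (real ^ 'd \<Rightarrow> 'b::euclidean_space) \<Rightarrow> real" where
  "Lp_norm p f = (LINT x|torus_measure. norm (f x) powr p) powr (1 / p)"

text \<open>\<open>G x $ i $ j\<close> is the weak derivative of the \<open>i\<close>-th component of \<open>f\<close> in direction \<open>j\<close>.\<close>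

definition is_weak_deriv :: "(real ^ 'd \<Rightarrow> real ^ 'd) \<Rightarrow> (real ^ 'd \<Rightarrow> real ^ 'd ^ 'd) \<Rightarrow> bool" where
  "is_weak_deriv f G \<longleftrightarrow> f \<in> Lp 1 \<and> G \<in> Lp 1 \<and>
     (\<forall>\<phi>. test_function \<phi> \<longrightarrow> (\<forall>i j.
        (LINT x|torus_measure. f x $ i * partial j \<phi> x) =
        - (LINT x|torus_measure. G x $ i $ j * \<phi> x)))"

text \<open>Weak derivatives are unique up to null sets, so the choice does not affect norms.\<close>

definition weak_deriv :: "(real ^ 'd \<Rightarrow> real ^ 'd) \<Rightarrow> real ^ 'd \<Rightarrow> real ^ 'd ^ 'd" where
  "weak_deriv f = (SOME G. is_weak_deriv f G)"

definition W1 :: "real \<Rightarrow> (real ^ 'd \<Rightarrow> real ^ 'd) set" where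
  "W1 r = {f \<in> Lp r. \<exists>G \<in> Lp r. is_weak_deriv f G}"

definition W1_norm :: "real \<Rightarrow> (real ^ 'd \<Rightarrow> real ^ 'd) \<Rightarrow> real" where
  "W1_norm r f = Lp_norm r f + Lp_norm r (weak_deriv f)"

text \<open>
  The space \<open>C((0,1); W\<^sup>1\<^sup>,\<^sup>r \<inter> L\<^sup>s)\<close>. Its elements are represented by jointly Borel functions of \<open>(t,x)\<close>;
  without joint measurability, agreement almost everywhere on \<open>(0,1) \<times> \<real>\<^sup>d/\<int>\<^sup>d\<close> would depend on the
  representatives chosen at the individual times. Every continuous curve of classes has such a
  representative, and it is unique up to null sets of space-time.
\<close>

definition C_W1_Lp :: "real \<Rightarrow> real \<Rightarrow> (real \<times> (real ^ 'd) \<Rightarrow> real ^ 'd) set" where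
  "C_W1_Lp r s = {u. borel_field u \<and>
     (\<forall>t\<in>{0<..<1}. (\<lambda>x. u (t, x)) \<in> W1 r \<inter> Lp s) \<and>
     (\<forall>t\<^sub>0\<in>{0<..<1}.
        ((\<lambda>t. W1_norm r (\<lambda>x. u (t, x) - u (t\<^sub>0, x)) + Lp_norm s (\<lambda>x. u (t, x) - u (t\<^sub>0, x)))
          \<longlongrightarrow> 0) (at t\<^sub>0 within {0<..<1}))}"

definition divergence_free :: "(real ^ 'd \<Rightarrow> real ^ 'd) \<Rightarrow> bool" where
  "divergence_free f \<longleftrightarrow>
     (\<forall>\<phi>. test_function \<phi> \<longrightarrow> (LINT x|torus_measure. (\<Sum>j\<in>UNIV. f x $ j * partial j \<phi> x)) = 0)"


subsection \<open>Integral curves\<close>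

definition absolutely_continuous_curve :: "(real \<Rightarrow> 'b::real_normed_vector) \<Rightarrow> bool" where
  "absolutely_continuous_curve \<gamma> \<longleftrightarrow>
     (\<forall>\<epsilon>>0. \<exists>\<delta>>0. \<forall>(n::nat) a b.
        (\<forall>i<n. 0 \<le> a i \<and> a i \<le> b i \<and> b i \<le> 1) \<longrightarrow>
        disjoint_family_on (\<lambda>i. {a i<..<b i}) {..<n} \<longrightarrow>
        (\<Sum>i<n. b i - a i) < \<delta> \<longrightarrow>
        (\<Sum>i<n. norm (\<gamma> (b i) - \<gamma> (a i))) < \<epsilon>)"

text \<open>
  A curve in the torus is represented by a lift to \<open>\<real>\<^sup>d\<close>: the absolutely continuous curves in the
  torus starting at the class of \<open>x\<close> are exactly the projections of the absolutely continuous curves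
  starting at \<open>x\<close>, each being the projection of exactly one of them, with the same derivative.
\<close>

definition integral_curve ::
    "(real \<times> (real ^ 'd) \<Rightarrow> real ^ 'd) \<Rightarrow> real ^ 'd \<Rightarrow> (real \<Rightarrow> real ^ 'd) \<Rightarrow> bool" where
  "integral_curve v x \<gamma> \<longleftrightarrow> absolutely_continuous_curve \<gamma> \<and> \<gamma> 0 = x \<and>
     (AE t in lborel. t \<in> {0<..<1} \<longrightarrow> (\<gamma> has_vector_derivative v (t, \<gamma> t)) (at t))"

text \<open>The curves are required to be pairwise distinct on \<open>[0,1]\<close> as curves in the torus.\<close>

definition at_least_integral_curves ::
    "nat \<Rightarrow> (real \<times> (real ^ 'd) \<Rightarrow> real ^ 'd) \<Rightarrow> real ^ 'd \<Rightarrow> bool" where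
  "at_least_integral_curves N v x \<longleftrightarrow>
     (\<exists>\<Gamma>. (\<forall>i<N. integral_curve v x (\<Gamma> i)) \<and>
          (\<forall>i<N. \<forall>j<N. i \<noteq> j \<longrightarrow> (\<exists>t\<in>{0..1}. \<not> torus_eq (\<Gamma> i t) (\<Gamma> j t))))"

end

theory Submission
  imports Defs
begin

text \<open>
  The field may blow up as \<open>t \<rightarrow> 0\<close>, so it can be \<open>C\<^sup>1\<close> in space at positive times and branch only at time \<open>0\<close>.
  With \<open>b = max N 2\<close>, write two of the coordinates in base \<open>b\<close> and single out one digit for each
  stage \<open>n\<close>, alternating between the two coordinates and moving quickly to finer scales. On the time
  interval \<open>[2\<^sup>-\<^sup>n\<^sup>-\<^sup>2, 2\<^sup>-\<^sup>n\<^sup>-\<^sup>1]\<close> the field is a smoothed shear that, run backwards, adds digit \<open>n + 1\<close>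
  to digit \<open>n\<close> modulo \<open>b\<close>. The displacements are summable, so trajectories converge as \<open>t \<rightarrow> 0\<close>, and
  the limit turns the digits \<open>a\<^sub>n\<close> into \<open>a\<^sub>n + a\<^sub>n\<^sub>+\<^sub>1\<close>, which is a \<open>b\<close>-to-one map: the first digit
  can be prescribed and determines the others. By Borel-Cantelli almost every limit point avoids,
  from some stage on, the thin sets where the shears are smoothed. Shears preserve Lebesgue measure
  and so null sets, and the \<open>b\<close> branches of the inverse of the limit map pull null sets back to null
  sets, hence changing the field on a null set does not matter for almost every starting point.
\<close>

section \<open>Integration over the torus\<close>

text \<open>Two requirements fix the constants. Borel-Cantelli wants the smoothing margins
  \<open>dl n\<close>, measured in cells of width 1 / \<open>Q n\<close>, to be summable. Reading
  digit n near the limit point wants all later displacements of the same coordinate to fit into that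
  margin. A fixed ratio of scales cannot give both, so \<open>Q\<close> grows like an exponential of
  n^2. Displacements of order 4^-n in stages of length 2^-(n+2) keep trajectories Lipschitz down to
  time 0; only spatial derivatives deteriorate there. Alternating the coordinates makes each stage a
  shear, whose gradient is trace-free and whose flow is explicit. The delicate point is the
  exceptional set. Changing the field on a null set spoils a null set of late positions z, whereas
  the claim concerns starting points at time 0, related to z by a many-to-one limit map. Its inverse
  branches \<open>start\<close> are only pointwise limits: cutting off the digits at a late stage
  leaves one of b translations followed by a measure-preserving map, and open covers of the spoiled
  set pass through this limit.\<close>

lemma borel_measurable_nth [measurable]: "(\<lambda>x::real^'n. x $ i) \<in> borel_measurable borel"
  by (intro borel_measurable_continuous_onI continuous_intros)

lemma has_derivative_nth [derivative_intros]:
  "(f has_derivative f') F \<Longrightarrow> ((\<lambda>x. f x $ i) has_derivative (\<lambda>h. f' h $ i)) F"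
  by (rule bounded_linear.has_derivative[OF bounded_linear_vec_nth])

lemma cell_borel [measurable]: "cell \<in> sets borel"
  unfolding cell_def by measurable

lemma cell_subset_cbox: "cell \<subseteq> cbox (0::real^'d) 1"
  by (auto simp: cell_def mem_box_cart less_imp_le)

lemma emeasure_cell_le_1: "emeasure lborel (cell :: (real^'d) set) \<le> 1"
proof -
  have "emeasure lborel (cell :: (real^'d) set) \<le> emeasure lborel (cbox (0::real^'d) 1)"
    by (rule emeasure_mono[OF cell_subset_cbox]) auto
  also have "\<dots> = ennreal (measure lborel (cbox (0::real^'d) 1))"
    by (intro emeasure_eq_ennreal_measure) (metis emeasure_lborel_cbox_finite order_less_irrefl infinity_ennreal_def)
  also have "measure lborel (cbox (0::real^'d) 1) = 1"
    by (subst content_cbox_cart) (auto simp: interval_ne_empty_cart)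
  finally show ?thesis by simp
qed

lemma finite_torus_measure: "finite_measure (torus_measure :: (real^'d) measure)"
proof
  have "emeasure torus_measure (space torus_measure :: (real^'d) set) = emeasure lborel (cell :: (real^'d) set)"
    by (simp add: torus_measure_def space_restrict_space emeasure_restrict_space)
  then show "emeasure torus_measure (space torus_measure :: (real^'d) set) \<noteq> \<infinity>"
    using emeasure_cell_le_1[where 'd='d] by (auto simp: top_unique)
qed

lemma space_torus_measure [simp]: "space torus_measure = cell"
  by (simp add: torus_measure_def space_restrict_space)

lemma measure_torus_le_1: "measure torus_measure (cell :: (real^'d) set) \<le> 1"
proof -
  have "emeasure torus_measure (cell :: (real^'d) set) = emeasure lborel (cell :: (real^'d) set)"
    by (simp add: torus_measure_def emeasure_restrict_space)
  then show ?thesis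
    using emeasure_cell_le_1[where 'd='d] by (simp add: measure_def enn2real_leI)
qed

lemma measurable_torus_measure: "f \<in> borel_measurable borel \<Longrightarrow> f \<in> borel_measurable torus_measure"
  unfolding torus_measure_def by (rule measurable_restrict_space1) simp

lemma AE_torus_measure_iff: "(AE x in torus_measure. P x) \<longleftrightarrow> (AE x in lborel. x \<in> cell \<longrightarrow> P x)"
  unfolding torus_measure_def by (subst AE_restrict_space_iff) auto

lemma integral_torus_measure:
  fixes f :: "real^'d \<Rightarrow> 'b::euclidean_space"
  shows "(LINT x|torus_measure. f x) = (LINT x|lborel. indicator cell x *\<^sub>R f x)"
  unfolding torus_measure_def by (subst integral_restrict_space) auto

lemma integrable_torus_bounded:
  fixes f :: "real^'d \<Rightarrow> 'b::euclidean_space"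
  assumes "f \<in> borel_measurable borel" and "\<And>x. x \<in> cell \<Longrightarrow> norm (f x) \<le> C"
  shows "integrable torus_measure f"
proof -
  interpret finite_measure "torus_measure :: (real^'d) measure" by (rule finite_torus_measure)
  show ?thesis
    by (rule integrable_const_bound[where B=C])
       (use assms in \<open>auto intro!: AE_I2 measurable_torus_measure\<close>)
qed

lemma int_lattice_uminus: "k \<in> int_lattice \<Longrightarrow> - k \<in> int_lattice"
  by (auto simp: int_lattice_def)

lemma axis_int_lattice: "axis k 1 \<in> int_lattice"
  by (auto simp: int_lattice_def axis_def)

lemma ex_cell_translate:
  fixes x :: "real^'d"
  shows "\<exists>k\<in>int_lattice. x + k \<in> cell"
proof
  show "x + (\<chi> i. - of_int \<lfloor>x $ i\<rfloor>) \<in> cell"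
    by (auto simp: cell_def) (smt (verit) real_of_int_floor_add_one_gt)
qed (auto simp: int_lattice_def)

lemma continuous_bounded_on_cell:
  fixes f :: "real^'d \<Rightarrow> 'b::real_normed_vector"
  assumes "continuous_on UNIV f"
  obtains C where "\<And>x. x \<in> cell \<Longrightarrow> norm (f x) \<le> C"
proof -
  have "compact (f ` cbox 0 1)"
    by (rule compact_continuous_image[OF continuous_on_subset[OF assms]]) auto
  then obtain C where "\<And>y. y \<in> f ` cbox 0 1 \<Longrightarrow> norm y \<le> C"
    using compact_imp_bounded bounded_iff by metis
  then show ?thesis using that cell_subset_cbox by blast
qed

lemma continuous_periodic_bounded:
  fixes f :: "real^'d \<Rightarrow> 'b::real_normed_vector"
  assumes "continuous_on UNIV f" "periodic f"
  obtains C where "\<And>x. norm (f x) \<le> C"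
proof -
  obtain C where C: "\<And>x. x \<in> cell \<Longrightarrow> norm (f x) \<le> C"
    using continuous_bounded_on_cell[OF assms(1)] by blast
  have "norm (f x) \<le> C" for x
    using ex_cell_translate[of x] C assms(2) unfolding periodic_def by metis
  then show ?thesis using that by blast
qed

lemma integrable_torus_continuous:
  fixes f :: "real^'d \<Rightarrow> 'b::euclidean_space"
  assumes "continuous_on UNIV f"
  shows "integrable torus_measure f"
  using continuous_bounded_on_cell[OF assms]
  by (metis assms borel_measurable_continuous_onI integrable_torus_bounded)

text \<open>The shifted cell is the disjoint union of \<open>A\<close> and of \<open>D\<close> moved
  by the full period \<open>e\<close>; periodicity of \<open>h\<close> moves the second piece back
  into the cell.\<close>

lemma integral_torus_translate:
  fixes h :: "real^'d \<Rightarrow> real"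
  assumes h[measurable]: "h \<in> borel_measurable borel" and per: "periodic h"
    and bd: "\<And>x. \<bar>h x\<bar> \<le> C" and s: "0 \<le> s" "s \<le> 1"
  shows "(LINT x|torus_measure. h (x + s *\<^sub>R axis k 1)) = (LINT x|torus_measure. h x)"
proof -
  define e :: "real^'d" where "e = axis k 1"
  define A where "A = cell \<inter> {x::real^'d. s \<le> x $ k}"
  define D where "D = cell \<inter> {x::real^'d. x $ k < s}"
  have [measurable]: "A \<in> sets borel" "D \<in> sets borel" by (auto simp: A_def D_def)
  have sub: "A \<subseteq> cell" "D \<subseteq> cell" by (auto simp: A_def D_def)
  have int: "integrable lborel (\<lambda>x. indicator S x * h x)" if S: "S \<subseteq> cell" "S \<in> sets borel" for S
  proof (rule Bochner_Integration.integrable_bound)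
    have "emeasure lborel S < \<infinity>"
      using emeasure_mono[OF S(1), of lborel] emeasure_cell_le_1[where 'd='d]
      by (auto simp: less_top[symmetric] top_unique)
    then show "integrable lborel (\<lambda>x. C * indicator S x)"
      using S by auto
    show "(\<lambda>x. indicator S x * h x) \<in> borel_measurable lborel" using S by simp
    show "AE x in lborel. norm (indicator S x * h x) \<le> norm (C * indicator S x)"
      using bd by (auto simp: indicator_def intro!: AE_I2) (meson abs_ge_self order_trans)
  qed
  have trans: "(LINT x|lborel. g (x + v)) = (LINT x|lborel. g x)"
    if [measurable]: "g \<in> borel_measurable borel" for g :: "real^'d \<Rightarrow> real" and v
  proof -
    have "(LINT x|lborel. g x) = (LINT x|distr lborel borel ((+) v). g x)"
      by (simp add: lborel_distr_plus)
    also have "\<dots> = (LINT x|lborel. g (v + x))"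
      by (rule integral_distr) auto
    finally show ?thesis by (simp add: add.commute)
  qed
  have per': "h (x - e) = h x" for x
    using per int_lattice_uminus[OF axis_int_lattice[of k]] unfolding periodic_def e_def by (metis diff_conv_add_uminus)
  have split: "indicator cell (x - s *\<^sub>R e) * h x
      = indicator A x * h x + indicator D (x - e) * h (x - e)" for x
  proof -
    have e: "e $ i = (if i = k then 1 else 0)" for i by (simp add: e_def axis_def)
    have "x - s *\<^sub>R e \<in> cell \<longleftrightarrow> (x \<in> A \<or> x - e \<in> D)"
    proof -
      have 1: "x - s *\<^sub>R e \<in> cell \<longleftrightarrow> (s \<le> x $ k \<and> x $ k < 1 + s) \<and> (\<forall>i. i \<noteq> k \<longrightarrow> 0 \<le> x $ i \<and> x $ i < 1)"
        by (auto simp: cell_def e; (smt (verit))?)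
      have 2: "x \<in> A \<longleftrightarrow> (s \<le> x $ k \<and> x $ k < 1) \<and> (\<forall>i. i \<noteq> k \<longrightarrow> 0 \<le> x $ i \<and> x $ i < 1)"
        unfolding A_def cell_def using s by (auto; (smt (verit))?)
      have 3: "x - e \<in> D \<longleftrightarrow> (1 \<le> x $ k \<and> x $ k < 1 + s) \<and> (\<forall>i. i \<noteq> k \<longrightarrow> 0 \<le> x $ i \<and> x $ i < 1)"
        unfolding D_def cell_def using s by (auto simp: e; (smt (verit))?)
      show ?thesis unfolding 1 2 3 using s by auto
    qed
    moreover have "\<not> (x \<in> A \<and> x - e \<in> D)"
      by (auto simp: A_def D_def cell_def e) (metis diff_ge_0_iff_ge not_le)
    ultimately show ?thesis by (auto simp: indicator_def per')
  qed
  have "(LINT x|torus_measure. h (x + s *\<^sub>R axis k 1))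
      = (LINT x|lborel. indicator cell ((x + s *\<^sub>R e) - s *\<^sub>R e) * h (x + s *\<^sub>R e))"
    by (simp add: integral_torus_measure e_def)
  also have "\<dots> = (LINT x|lborel. indicator cell (x - s *\<^sub>R e) * h x)"
    by (rule trans[of "\<lambda>x. indicator cell (x - s *\<^sub>R e) * h x"]) measurable
  also have "\<dots> = (LINT x|lborel. indicator A x * h x + indicator D (x - e) * h (x - e))"
    by (simp only: split)
  also have "\<dots> = (LINT x|lborel. indicator A x * h x) + (LINT x|lborel. indicator D (x - e) * h (x - e))"
  proof (rule Bochner_Integration.integral_add)
    show "integrable lborel (\<lambda>x. indicator D (x - e) * h (x - e))"
    proof -
      have "integrable (distr lborel borel ((+) (- e))) (\<lambda>x. indicator D x * h x)"
        unfolding lborel_distr_plus using int[OF sub(2)] by simp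
      then show ?thesis by (subst (asm) integrable_distr_eq) auto
    qed
  qed (rule int[OF sub(1)], simp)
  also have "(LINT x|lborel. indicator D (x - e) * h (x - e)) = (LINT x|lborel. indicator D x * h x)"
    using trans[of "\<lambda>x. indicator D x * h x" "- e"] by simp
  also have "(LINT x|lborel. indicator A x * h x) + (LINT x|lborel. indicator D x * h x)
      = (LINT x|lborel. indicator A x * h x + indicator D x * h x)"
    by (rule Bochner_Integration.integral_add[symmetric]) (use int sub in auto)
  also have "\<dots> = (LINT x|lborel. indicator cell x * h x)"
    by (rule Bochner_Integration.integral_cong) (auto simp: A_def D_def indicator_def)
  finally show ?thesis by (simp add: integral_torus_measure)
qed

text \<open>By translation invariance the integral equals its average over all shifts
  \<open>s *\<^sub>R e\<close> with s in [0,1]. After Fubini the inner integral runs over one full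
  period of \<open>g\<close> along a line and vanishes by the fundamental theorem of
  calculus.\<close>

lemma integral_torus_deriv_eq_0:
  fixes g :: "real^'d \<Rightarrow> real"
  assumes der: "\<And>x. (g has_derivative g' x) (at x)"
    and cont: "continuous_on UNIV (\<lambda>x. g' x (axis k 1))"
    and per: "periodic g" and per': "periodic (\<lambda>x. g' x (axis k 1))"
  shows "(LINT x|torus_measure. g' x (axis k 1)) = 0"
proof -
  define D where "D = (\<lambda>x. g' x (axis k 1))"
  define e :: "real^'d" where "e = axis k 1"
  have contD: "continuous_on UNIV D" using cont by (simp add: D_def)
  then have Dm[measurable]: "D \<in> borel_measurable borel" by (rule borel_measurable_continuous_onI)
  obtain C where C: "\<And>x. norm (D x) \<le> C"
    using continuous_periodic_bounded[OF contD] per' by (auto simp: D_def)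
  have C0: "C \<ge> 0" using C[of 0] norm_ge_zero order_trans by blast
  have line: "((\<lambda>s. g (x + s *\<^sub>R e)) has_real_derivative D (x + s *\<^sub>R e)) (at s)" for x s
  proof -
    have lin: "linear (g' (x + s *\<^sub>R e))" using der has_derivative_linear by blast
    have "((\<lambda>s. g (x + s *\<^sub>R e)) has_derivative (\<lambda>h. g' (x + s *\<^sub>R e) (h *\<^sub>R e))) (at s)"
      by (rule has_derivative_compose[OF _ der, where f="\<lambda>s. x + s *\<^sub>R e"])
         (auto intro!: derivative_eq_intros)
    then show ?thesis
      unfolding has_field_derivative_def D_def e_def[symmetric]
      by (simp add: linear_scale[OF lin] mult.commute[of _ "g' _ _"])
  qed
  have FTC: "(LINT s|lborel. D (x + s *\<^sub>R e) * indicator {0..1} s) = 0" for x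
  proof -
    have "(LINT s|lborel. D (x + s *\<^sub>R e) * indicator {0..1} s) = g (x + 1 *\<^sub>R e) - g (x + 0 *\<^sub>R e)"
    proof (rule integral_FTC_Icc_real[OF _ line])
      have "continuous_on UNIV (\<lambda>s. D (x + s *\<^sub>R e))"
        by (auto intro!: continuous_on_compose2[OF contD] continuous_intros)
      then show "isCont (\<lambda>s. D (x + s *\<^sub>R e)) s" for s
        by (simp add: continuous_on_eq_continuous_at)
    qed simp
    also have "\<dots> = 0" using per axis_int_lattice unfolding periodic_def e_def by auto
    finally show ?thesis .
  qed
  define \<Psi> where "\<Psi> = (\<lambda>x s. indicator cell x * (D (x + s *\<^sub>R e) * indicator {0..1} s))"
  have int: "integrable (lborel \<Otimes>\<^sub>M lborel) (case_prod \<Psi>)"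
  proof (rule Bochner_Integration.integrable_bound)
    have "emeasure (lborel \<Otimes>\<^sub>M lborel) ((cell :: (real^'d) set) \<times> {0..1::real})
        = emeasure lborel (cell :: (real^'d) set) * emeasure lborel {0..1::real}"
      by (rule lborel.emeasure_pair_measure_Times) auto
    also have "\<dots> < \<infinity>"
      using emeasure_cell_le_1[where 'd='d] by (auto simp: less_top[symmetric] top_unique)
    finally have "emeasure (lborel \<Otimes>\<^sub>M lborel) ((cell :: (real^'d) set) \<times> {0..1::real}) < \<infinity>" .
    moreover have "(cell :: (real^'d) set) \<times> {0..1::real} \<in> sets (lborel \<Otimes>\<^sub>M lborel)"
      by (rule pair_measureI) auto
    ultimately show "integrable (lborel \<Otimes>\<^sub>M lborel)
        (\<lambda>p. C * indicator ((cell :: (real^'d) set) \<times> {0..1::real}) p :: real)"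
      by (intro integrable_mult_right integrable_real_indicator)
    show "case_prod \<Psi> \<in> borel_measurable (lborel \<Otimes>\<^sub>M lborel)"
      unfolding \<Psi>_def by measurable
    show "AE p in lborel \<Otimes>\<^sub>M lborel. norm (case_prod \<Psi> p) \<le> norm (C * indicator ((cell :: (real^'d) set) \<times> {0..1::real}) p :: real)"
      using C C0 by (auto simp: \<Psi>_def indicator_def intro!: AE_I2)
  qed
  have "0 = (LINT x|lborel. (LINT s|lborel. \<Psi> x s))"
    unfolding \<Psi>_def by (simp add: FTC)
  also have "\<dots> = (LINT s|lborel. (LINT x|lborel. \<Psi> x s))"
    by (rule lborel_pair.Fubini_integral[OF int, symmetric])
  also have "\<dots> = (LINT s|lborel. indicator {0..1::real} s * (LINT x|torus_measure. D x))"
  proof (rule Bochner_Integration.integral_cong[OF refl])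
    fix s :: real
    show "(LINT x|lborel. \<Psi> x s) = indicator {0..1} s * (LINT x|torus_measure. D x)"
    proof (cases "s \<in> {0..1}")
      case True
      then have "(LINT x|lborel. \<Psi> x s) = (LINT x|torus_measure. D (x + s *\<^sub>R axis k 1))"
        by (simp add: \<Psi>_def integral_torus_measure e_def)
      also have "\<dots> = (LINT x|torus_measure. D x)"
        by (rule integral_torus_translate[where C=C]) (use True C per' in \<open>auto simp: D_def[symmetric]\<close>)
      finally show ?thesis using True by simp
    qed (simp add: \<Psi>_def)
  qed
  also have "\<dots> = (LINT x|torus_measure. D x)" by simp
  finally show ?thesis by (simp add: D_def)
qed

section \<open>Trigonometric polynomials and the fundamental lemma\<close>

text \<open>A supply of explicit test functions: an algebra closed under partial derivatives, rich
  enough by Stone-Weierstrass to approximate indicators of compact sets.\<close>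

inductive trig_poly :: "(real^'d \<Rightarrow> real) \<Rightarrow> bool" where
  const: "trig_poly (\<lambda>x. c)"
| cos: "trig_poly (\<lambda>x. cos (2 * pi * x $ i))"
| sin: "trig_poly (\<lambda>x. sin (2 * pi * x $ i))"
| add: "trig_poly f \<Longrightarrow> trig_poly g \<Longrightarrow> trig_poly (\<lambda>x. f x + g x)"
| mult: "trig_poly f \<Longrightarrow> trig_poly g \<Longrightarrow> trig_poly (\<lambda>x. f x * g x)"

lemma trig_poly_sum: "finite I \<Longrightarrow> (\<And>i. i \<in> I \<Longrightarrow> trig_poly (f i)) \<Longrightarrow> trig_poly (\<lambda>x. \<Sum>i\<in>I. f i x)"
  by (induction rule: finite_induct) (auto intro: trig_poly.intros)

lemma trig_poly_deriv:
  assumes "trig_poly f"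
  shows "\<exists>f'. (\<forall>x. (f has_derivative f' x) (at x)) \<and> (\<forall>j. trig_poly (\<lambda>x. f' x (axis j 1)))"
  using assms
proof induction
  case (const c)
  show ?case by (intro exI[of _ "\<lambda>x h. 0"]) (auto intro: trig_poly.intros)
next
  case (cos i)
  show ?case
    by (intro exI[of _ "\<lambda>x h. - (2 * pi * h $ i) * sin (2 * pi * x $ i)"] conjI allI trig_poly.intros)
       (auto intro!: derivative_eq_intros)
next
  case (sin i)
  show ?case
    by (intro exI[of _ "\<lambda>x h. (2 * pi * h $ i) * cos (2 * pi * x $ i)"] conjI allI trig_poly.intros)
       (auto intro!: derivative_eq_intros)
next
  case (add f g)
  then obtain f' g' where "\<forall>x. (f has_derivative f' x) (at x)" "\<forall>j. trig_poly (\<lambda>x. f' x (axis j 1))"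
    "\<forall>x. (g has_derivative g' x) (at x)" "\<forall>j. trig_poly (\<lambda>x. g' x (axis j 1))" by blast
  then show ?case
    by (intro exI[of _ "\<lambda>x h. f' x h + g' x h"]) (auto intro!: has_derivative_add trig_poly.intros)
next
  case (mult f g)
  then obtain f' g' where "\<forall>x. (f has_derivative f' x) (at x)" "\<forall>j. trig_poly (\<lambda>x. f' x (axis j 1))"
    "\<forall>x. (g has_derivative g' x) (at x)" "\<forall>j. trig_poly (\<lambda>x. g' x (axis j 1))" by blast
  with mult.hyps show ?case
    by (intro exI[of _ "\<lambda>x h. f x * g' x h + f' x h * g x"])
       (auto intro!: has_derivative_mult trig_poly.intros)
qed

lemma trig_poly_partial: "trig_poly f \<Longrightarrow> trig_poly (partial j f)"
proof -
  assume "trig_poly f"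
  then obtain f' where f': "\<forall>x. (f has_derivative f' x) (at x)" "\<forall>j. trig_poly (\<lambda>x. f' x (axis j 1))"
    using trig_poly_deriv by blast
  have "partial j f = (\<lambda>x. f' x (axis j 1))"
    unfolding partial_def using frechet_derivative_at f'(1) by metis
  then show ?thesis using f'(2) by simp
qed

lemma trig_poly_differentiable: "trig_poly f \<Longrightarrow> f differentiable_on UNIV"
  unfolding differentiable_on_def differentiable_def using trig_poly_deriv by blast

lemma trig_poly_continuous: "trig_poly f \<Longrightarrow> continuous_on UNIV f"
  by (intro differentiable_imp_continuous_on trig_poly_differentiable)

lemma trig_poly_smooth: "trig_poly f \<Longrightarrow> smooth f"
proof -
  have "trig_poly f \<Longrightarrow> trig_poly (fold partial js f)" for js
    by (induction js arbitrary: f) (auto intro: trig_poly_partial)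
  then show "trig_poly f \<Longrightarrow> smooth f"
    by (auto simp: smooth_def intro: trig_poly_differentiable)
qed

lemma cos_sin_add_int:
  assumes "k \<in> \<int>"
  shows "cos (2 * pi * (x + k)) = cos (2 * pi * x)" "sin (2 * pi * (x + k)) = sin (2 * pi * x)"
proof -
  obtain n where k: "k = of_int n" using assms by (auto elim: Ints_cases)
  show "cos (2 * pi * (x + k)) = cos (2 * pi * x)" "sin (2 * pi * (x + k)) = sin (2 * pi * x)"
    using cos_int_2pin[of n] sin_int_2pin[of n]
    unfolding k distrib_left cos_add sin_add by simp_all
qed

lemma trig_poly_periodic: "trig_poly f \<Longrightarrow> periodic f"
  by (induction rule: trig_poly.induct) (auto simp: periodic_def int_lattice_def cos_sin_add_int)

lemma test_function_trig_poly: "trig_poly f \<Longrightarrow> test_function f"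
  by (simp add: test_function_def trig_poly_smooth trig_poly_periodic)

text \<open>The torus as a product of d circles in Euclidean space of dimension 2d. Ordinary
  polynomials there pull back to trigonometric polynomials.\<close>

definition torus_embed :: "real^'d \<Rightarrow> (real^'d) \<times> (real^'d)" where
  "torus_embed x = (\<chi> i. cos (2 * pi * x $ i), \<chi> i. sin (2 * pi * x $ i))"

lemma continuous_torus_embed: "continuous_on S torus_embed"
  unfolding torus_embed_def by (intro continuous_intros)

lemma torus_embed_eq_iff: "torus_embed x = torus_embed y \<longleftrightarrow> torus_eq x y"
proof -
  have "torus_embed x = torus_embed y \<longleftrightarrow>
      (\<forall>i. sin (2 * pi * x $ i) = sin (2 * pi * y $ i) \<and> cos (2 * pi * x $ i) = cos (2 * pi * y $ i))"
    by (auto simp: torus_embed_def vec_eq_iff)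
  also have "\<dots> \<longleftrightarrow> (\<forall>i. \<exists>n::int. x $ i = y $ i + n)"
  proof -
    have "2 * pi * a = 2 * pi * b + 2 * pi * c \<longleftrightarrow> a = b + c" for a b c :: real
      by (simp flip: ring_distribs)
    then show ?thesis by (simp add: sin_cos_eq_iff)
  qed
  also have "\<dots> \<longleftrightarrow> torus_eq x y"
    by (auto simp: torus_eq_def int_lattice_def Ints_def image_iff algebra_simps)
  finally show ?thesis .
qed

lemma trig_poly_compose_embed:
  "real_polynomial_function p \<Longrightarrow> trig_poly (\<lambda>x. p (torus_embed x))"
proof (induction rule: real_polynomial_function.induct)
  case (linear f)
  have "f (torus_embed x) = (\<Sum>i\<in>UNIV. f (axis i 1, 0) * cos (2 * pi * x $ i))
      + (\<Sum>i\<in>UNIV. f (0, axis i 1) * sin (2 * pi * x $ i))" for x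
  proof -
    interpret f: bounded_linear f by fact
    have "torus_embed x = (\<Sum>i\<in>UNIV. cos (2 * pi * x $ i) *\<^sub>R (axis i 1, 0))
      + (\<Sum>i\<in>UNIV. sin (2 * pi * x $ i) *\<^sub>R (0, axis i 1))"
      unfolding torus_embed_def prod_eq_iff fst_add snd_add fst_sum snd_sum
      by (auto simp: vec_eq_iff axis_def if_distrib cong: if_cong)
    then have "f (torus_embed x) = (\<Sum>i\<in>UNIV. f (cos (2 * pi * x $ i) *\<^sub>R (axis i 1, 0)))
      + (\<Sum>i\<in>UNIV. f (sin (2 * pi * x $ i) *\<^sub>R (0, axis i 1)))"
      by (simp only: f.add f.sum)
    then show ?thesis by (simp only: f.scaleR real_scaleR_def mult.commute)
  qed
  then show ?case by (auto intro!: trig_poly.intros trig_poly_sum)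
qed (auto intro: trig_poly.intros)

text \<open>On the cell, the indicator of \<open>A\<close> is a bounded pointwise limit of
  trigonometric polynomials: the cut-offs \<open>h k\<close> shrink to the embedded
  \<open>A\<close>, and a polynomial follows each of them up to 1 / (k + 1). Since \<open>A\<close>
  lies in the open box, no other point of the cell has the same image as a point of
  \<open>A\<close>.\<close>

lemma integral_compact_eq_0:
  fixes H :: "real^'d \<Rightarrow> real"
  assumes H: "integrable torus_measure H"
    and ortho: "\<And>\<phi>. trig_poly \<phi> \<Longrightarrow> (LINT x|torus_measure. H x * \<phi> x) = 0"
    and A: "compact A" "A \<subseteq> box 0 1"
  shows "(LINT x|torus_measure. H x * indicator A x) = 0"
\<comment> \<open>\<open>infdist\<close> to the empty set is 0 by convention, which would turn
  \<open>h k\<close> into the constant 1.\<close>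
proof (cases "A = {}")
  case False
  let ?F = "torus_embed ` A"
  have "compact ?F" by (rule compact_continuous_image[OF continuous_torus_embed A(1)])
  then have clF: "closed ?F" by (rule compact_imp_closed)
  define h where "h = (\<lambda>(k::nat) w. max 0 (1 - real k * infdist w ?F))"
  have "\<exists>p. real_polynomial_function p \<and> (\<forall>w\<in>torus_embed ` cbox 0 1. \<bar>h k w - p w\<bar> < 1 / Suc k)" for k
  proof -
    have "compact (torus_embed ` cbox (0::real^'d) 1)"
      by (intro compact_continuous_image continuous_torus_embed) auto
    moreover have "continuous_on (torus_embed ` cbox (0::real^'d) 1) (h k)"
      unfolding h_def by (intro continuous_intros)
    ultimately obtain p where "real_polynomial_function p"
      "\<And>w. w \<in> torus_embed ` cbox (0::real^'d) 1 \<Longrightarrow> \<bar>h k w - p w\<bar> < 1 / Suc k"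
      by (rule Stone_Weierstrass_real_polynomial_function[of _ _ "1 / Suc k"]) auto
    then show ?thesis by blast
  qed
  then obtain p where p: "\<And>k. real_polynomial_function (p k)"
    "\<And>k w. w \<in> torus_embed ` cbox 0 1 \<Longrightarrow> \<bar>h k w - p k w\<bar> < 1 / Suc k" by metis
  define \<phi> where "\<phi> k x = p k (torus_embed x)" for k and x :: "real^'d"
  have trig: "trig_poly (\<phi> k)" for k
    unfolding \<phi>_def by (rule trig_poly_compose_embed[OF p(1)])
  have close: "\<bar>h k (torus_embed x) - \<phi> k x\<bar> < 1 / Suc k" if "x \<in> cell" for k x
    unfolding \<phi>_def using that cell_subset_cbox by (intro p(2)) auto
  have lim_h: "(\<lambda>k. h k (torus_embed x)) \<longlonglongrightarrow> indicator A x" if x: "x \<in> cell" for x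
  proof (cases "x \<in> A")
    case True
    then have "infdist (torus_embed x) ?F = 0" by (intro infdist_zero) auto
    then show ?thesis using True by (simp add: h_def)
  next
    case xA: False
    have "torus_embed x \<notin> ?F"
    proof
      assume "torus_embed x \<in> ?F"
      then obtain y where y: "y \<in> A" "torus_eq x y" by (auto simp: torus_embed_eq_iff)
      have "x $ i = y $ i" for i
      proof -
        have "x $ i - y $ i \<in> \<int>" using y by (auto simp: torus_eq_def int_lattice_def)
        then obtain n where n: "x $ i - y $ i = of_int n" by (auto elim: Ints_cases)
        moreover have "0 \<le> x $ i" "x $ i < 1" using x by (auto simp: cell_def)
        moreover have "0 < y $ i" "y $ i < 1" using y A(2) by (auto simp: mem_box_cart)
        ultimately have "real_of_int n < 1" "real_of_int n > -1" by linarith+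
        then have "n = 0" by linarith
        then show ?thesis using n by simp
      qed
      then have "x = y" by (simp add: vec_eq_iff)
      then show False using xA y by simp
    qed
    then have pos: "infdist (torus_embed x) ?F > 0"
      using in_closed_iff_infdist_zero[OF clF] False infdist_nonneg[of "torus_embed x" ?F]
      by (metis antisym_conv2 image_is_empty)
    have "eventually (\<lambda>k. h k (torus_embed x) = 0) sequentially"
    proof -
      obtain K :: nat where K: "1 / infdist (torus_embed x) ?F \<le> real K" using real_arch_simple by blast
      have "h k (torus_embed x) = 0" if "k \<ge> K" for k
      proof -
        have "1 / infdist (torus_embed x) ?F \<le> real k" using K that by linarith
        then show ?thesis using pos by (simp add: h_def field_simps)
      qed
      then show ?thesis using eventually_sequentially by blast
    qed
    then show ?thesis using xA by (simp add: tendsto_eventually)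
  qed
  have lim: "(\<lambda>k. \<phi> k x) \<longlonglongrightarrow> indicator A x" if x: "x \<in> cell" for x
  proof -
    have "(\<lambda>k. \<phi> k x - h k (torus_embed x)) \<longlonglongrightarrow> 0"
    proof (rule tendsto_rabs_zero_cancel, rule tendsto_sandwich[of "\<lambda>_. 0" _ _ "\<lambda>k. 1 / Suc k"])
      show "(\<lambda>k. 1 / real (Suc k)) \<longlonglongrightarrow> 0" by (rule LIMSEQ_Suc[OF lim_1_over_n])
    qed (use close[OF x] in \<open>auto simp: abs_minus_commute less_imp_le\<close>)
    from tendsto_add[OF this lim_h[OF x]] show ?thesis by simp
  qed
  have Hm[measurable]: "H \<in> borel_measurable torus_measure" using H by auto
  have [measurable]: "\<phi> k \<in> borel_measurable torus_measure" for k
    by (intro measurable_torus_measure borel_measurable_continuous_onI trig_poly_continuous trig)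
  have [measurable]: "A \<in> sets borel" using A by (simp add: borel_compact)
  have [measurable]: "(\<lambda>x. indicator A x :: real) \<in> borel_measurable torus_measure"
    by (intro measurable_torus_measure) measurable
  have "(\<lambda>k. LINT x|torus_measure. H x * \<phi> k x) \<longlonglongrightarrow> (LINT x|torus_measure. H x * indicator A x)"
  proof (rule integral_dominated_convergence[where w="\<lambda>x. norm (H x) * 2"])
    show "integrable torus_measure (\<lambda>x. norm (H x) * 2)" using H by auto
    show "AE x in torus_measure. (\<lambda>k. H x * \<phi> k x) \<longlonglongrightarrow> H x * indicator A x"
      by (rule AE_I2) (auto intro!: tendsto_mult lim)
    show "AE x in torus_measure. norm (H x * \<phi> k x) \<le> norm (H x) * 2" for k
    proof (rule AE_I2)
      fix x :: "real^'d" assume "x \<in> space torus_measure"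
      then have "\<bar>h k (torus_embed x) - \<phi> k x\<bar> < 1 / Suc k" by (intro close) simp
      moreover have "1 / real (Suc k) \<le> 1" by auto
      moreover have "0 \<le> h k (torus_embed x)" "h k (torus_embed x) \<le> 1"
        by (auto simp: h_def infdist_nonneg)
      ultimately have "\<bar>\<phi> k x\<bar> \<le> 2" by linarith
      then show "norm (H x * \<phi> k x) \<le> norm (H x) * 2" by (simp add: abs_mult mult_left_mono)
    qed
  qed measurable
  moreover have "(LINT x|torus_measure. H x * \<phi> k x) = 0" for k by (rule ortho[OF trig])
  ultimately show ?thesis by (simp add: LIMSEQ_const_iff)
qed simp

lemma AE_torus_interior: "AE x in (torus_measure :: (real^'d) measure). x \<in> box 0 1"
proof -
  have "negligible (cbox (0::real^'d) 1 - box 0 1)" by (rule negligible_frontier_interval)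
  then have "AE x::real^'d in lebesgue. x \<notin> cbox 0 1 - box 0 1"
    by (intro AE_not_in) (simp add: negligible_iff_null_sets)
  then have "AE x::real^'d in lborel. x \<notin> cbox 0 1 - box 0 1"
    by (simp add: AE_completion_iff)
  then show ?thesis unfolding AE_torus_measure_iff
    using cell_subset_cbox by (auto elim!: eventually_mono)
qed

text \<open>Inner regularity: on a closed subset \<open>T\<close> of the positivity set
  \<open>S\<close> the integral of \<open>H\<close> vanishes, so \<open>T\<close> is null, while the
  remainder of \<open>S\<close> can be made as small as desired.\<close>

lemma AE_torus_nonpos:
  fixes H :: "real^'d \<Rightarrow> real"
  assumes H: "integrable torus_measure H" and Hm[measurable]: "H \<in> borel_measurable borel"
    and ortho: "\<And>\<phi>. trig_poly \<phi> \<Longrightarrow> (LINT x|torus_measure. H x * \<phi> x) = 0"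
  shows "AE x in torus_measure. H x \<le> 0"
proof -
  define S where "S = {x \<in> box 0 1. H x > 0}"
  have S[measurable]: "S \<in> sets borel" unfolding S_def by measurable
  have small: "emeasure lebesgue S \<le> ennreal \<epsilon>" if \<epsilon>: "\<epsilon> > 0" for \<epsilon>
  proof -
    have "S \<in> sets lebesgue" using S by auto
    then obtain T where T: "closed T" "T \<subseteq> S" "S - T \<in> lmeasurable" "emeasure lebesgue (S - T) < ennreal \<epsilon>"
      using sets_lebesgue_inner_closed[OF _ \<epsilon>] by blast
    have TB: "T \<subseteq> box 0 1" using T by (auto simp: S_def)
    then have "compact T" using T(1) bounded_subset[OF bounded_box] by (auto simp: compact_eq_bounded_closed)
    then have 0: "(LINT x|torus_measure. H x * indicator T x) = 0"
      by (intro integral_compact_eq_0 H ortho TB)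
    have Tm[measurable]: "T \<in> sets borel" using T by auto
    have int: "integrable torus_measure (\<lambda>x. H x * indicator T x)"
    proof (rule Bochner_Integration.integrable_bound[OF H])
      show "(\<lambda>x. H x * indicator T x) \<in> borel_measurable torus_measure"
        by (intro measurable_torus_measure) measurable
    qed (auto simp: indicator_def)
    have "(LINT x|torus_measure. H x * indicator T x) = 0 \<longleftrightarrow> (AE x in torus_measure. H x * indicator T x = 0)"
      by (rule integral_nonneg_eq_0_iff_AE[OF int]) (use T(2) in \<open>auto simp: S_def indicator_def less_imp_le intro!: AE_I2\<close>)
    then have "AE x in lborel. x \<in> cell \<longrightarrow> H x * indicator T x = 0"
      using 0 by (simp add: AE_torus_measure_iff)
    moreover have "T \<subseteq> cell"
      using TB by (auto simp: cell_def mem_box_cart subset_iff less_imp_le)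
    ultimately have "AE x in lborel. x \<notin> T"
      using T(2) by (auto elim!: eventually_mono simp: S_def)
    then have "emeasure lborel T = 0"
      by (subst (asm) AE_iff_measurable[of T]) auto
    then have "emeasure lebesgue T = 0" by simp
    have "emeasure lebesgue S = emeasure lebesgue (T \<union> (S - T))"
      using T(2) by (simp add: Un_absorb1)
    also have "\<dots> \<le> emeasure lebesgue T + emeasure lebesgue (S - T)"
      by (rule emeasure_subadditive) (use T in auto)
    also have "\<dots> \<le> ennreal \<epsilon>" using T(4) \<open>emeasure lebesgue T = 0\<close> by simp
    finally show ?thesis .
  qed
  have "emeasure lebesgue S \<le> 0"
  proof (rule ennreal_le_epsilon)
    fix \<epsilon> :: real assume "0 < \<epsilon>"
    from small[OF this] show "emeasure lebesgue S \<le> 0 + ennreal \<epsilon>" by simp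
  qed
  then have "emeasure lborel S = 0" by simp
  then have "AE x in lborel. x \<notin> S"
    by (intro AE_not_in) auto
  moreover have "AE x in lborel. x \<in> cell \<longrightarrow> x \<in> box 0 (1::real^'d)"
    using AE_torus_interior by (simp add: AE_torus_measure_iff)
  ultimately show ?thesis unfolding AE_torus_measure_iff
    by eventually_elim (auto simp: S_def)
qed

lemma fundamental_lemma_torus:
  fixes H :: "real^'d \<Rightarrow> real"
  assumes H: "integrable torus_measure H" and Hm: "H \<in> borel_measurable borel"
    and ortho: "\<And>\<phi>. test_function \<phi> \<Longrightarrow> (LINT x|torus_measure. H x * \<phi> x) = 0"
  shows "AE x in torus_measure. H x = 0"
proof -
  have "AE x in torus_measure. H x \<le> 0"
    using assms by (intro AE_torus_nonpos) (auto intro: test_function_trig_poly)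
  moreover have "AE x in torus_measure. - H x \<le> 0"
    using assms by (intro AE_torus_nonpos) (auto intro: test_function_trig_poly)
  ultimately show ?thesis by eventually_elim simp
qed

section \<open>Weak derivatives\<close>

lemma test_function_differentiable:
  assumes "test_function \<phi>"
  shows "(\<phi> has_derivative frechet_derivative \<phi> (at x)) (at x)" and "continuous_on UNIV \<phi>"
    and "continuous_on UNIV (partial j \<phi>)"
proof -
  have sm: "fold partial js \<phi> differentiable_on UNIV" for js
    using assms by (simp add: test_function_def smooth_def)
  from sm[of "[]"] have "\<phi> differentiable (at x)" by (simp add: differentiable_on_def)
  then show "(\<phi> has_derivative frechet_derivative \<phi> (at x)) (at x)"
    by (simp add: frechet_derivative_works)
  show "continuous_on UNIV \<phi>" "continuous_on UNIV (partial j \<phi>)"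
    using differentiable_imp_continuous_on sm[of "[]"] sm[of "[j]"] by auto
qed

lemma test_function_partial_periodic:
  fixes \<phi> :: "real^'d \<Rightarrow> real"
  assumes "test_function \<phi>"
  shows "periodic (partial j \<phi>)"
  unfolding periodic_def
proof (intro allI ballI)
  fix x k :: "real^'d" assume k: "k \<in> int_lattice"
  have per: "(\<lambda>y. \<phi> (y + k)) = \<phi>"
    using assms k by (auto simp: test_function_def periodic_def)
  have "((\<lambda>y. \<phi> (y + k)) has_derivative (\<lambda>h. frechet_derivative \<phi> (at (x + k)) h)) (at x)"
    by (rule has_derivative_compose[OF _ test_function_differentiable(1)[OF assms], where f="\<lambda>y. y + k"])
       (auto intro!: derivative_eq_intros)
  then have "(\<phi> has_derivative frechet_derivative \<phi> (at (x + k))) (at x)" by (simp add: per)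
  from frechet_derivative_at[OF this] show "partial j \<phi> (x + k) = partial j \<phi> x"
    by (simp add: partial_def)
qed

lemma continuous_periodic_Lp:
  fixes f :: "real^'d \<Rightarrow> 'b::euclidean_space"
  assumes "continuous_on UNIV f" "periodic f" "p > 0"
  shows "f \<in> Lp p"
proof -
  obtain C where C: "\<And>x. norm (f x) \<le> C"
    using continuous_periodic_bounded assms by blast
  have m[measurable]: "f \<in> borel_measurable borel" using assms by (intro borel_measurable_continuous_onI)
  have "integrable torus_measure (\<lambda>x. norm (f x) powr p)"
  proof (rule integrable_torus_bounded[where C="C powr p"])
    show "norm (norm (f x) powr p) \<le> C powr p" for x
      using C[of x] assms(3) by (auto intro!: powr_mono2)
  qed measurable
  then show ?thesis using assms m by (simp add: Lp_def)
qed

text \<open>Integration by parts: the partial derivative of the periodic product of a component of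
  \<open>f\<close> with \<phi> has integral 0.\<close>

lemma is_weak_deriv_classical:
  fixes f :: "real^'d \<Rightarrow> real^'d"
  assumes der: "\<And>x. (f has_derivative (\<lambda>h. G x *v h)) (at x)"
    and contG: "continuous_on UNIV G" and perf: "periodic f" and perG: "periodic G"
  shows "is_weak_deriv f G"
proof -
  have contf: "continuous_on UNIV f"
    by (rule has_derivative_continuous_on) (rule has_derivative_at_withinI[OF der])
  have "(LINT x|torus_measure. f x $ i * partial j \<phi> x) = - (LINT x|torus_measure. G x $ i $ j * \<phi> x)"
    if \<phi>: "test_function \<phi>" for \<phi> i j
  proof -
    note td = test_function_differentiable[OF \<phi>]
    let ?D = "\<lambda>x h. f x $ i * frechet_derivative \<phi> (at x) h + (G x *v h) $ i * \<phi> x"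
    have D: "?D x (axis j 1) = f x $ i * partial j \<phi> x + G x $ i $ j * \<phi> x" for x
      by (simp add: partial_def matrix_vector_mult_basis column_def)
    have c: "continuous_on UNIV (\<lambda>x. f x $ i * partial j \<phi> x)" "continuous_on UNIV (\<lambda>x. G x $ i $ j * \<phi> x)"
      by (intro continuous_intros contf contG td)+
    have "(LINT x|torus_measure. ?D x (axis j 1)) = 0"
    proof (rule integral_torus_deriv_eq_0)
      show "((\<lambda>x. f x $ i * \<phi> x) has_derivative ?D x) (at x)" for x
        using has_derivative_mult[OF has_derivative_nth[OF der, of i x] td(1)[of x]] by simp
      show "continuous_on UNIV (\<lambda>x. ?D x (axis j 1))"
        unfolding D by (intro continuous_intros c)
      show "periodic (\<lambda>x. f x $ i * \<phi> x)" "periodic (\<lambda>x. ?D x (axis j 1))"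
        using perf perG \<phi> test_function_partial_periodic[OF \<phi>, of j]
        unfolding D by (auto simp: periodic_def test_function_def)
    qed
    then have "(LINT x|torus_measure. f x $ i * partial j \<phi> x) + (LINT x|torus_measure. G x $ i $ j * \<phi> x) = 0"
      unfolding D by (subst (asm) Bochner_Integration.integral_add) (intro integrable_torus_continuous c)+
    then show ?thesis by simp
  qed
  then show ?thesis
    unfolding is_weak_deriv_def
    using continuous_periodic_Lp[OF contf perf, of 1] continuous_periodic_Lp[OF contG perG, of 1] by auto
qed

text \<open>\<open>W1_norm\<close> refers to a weak derivative selected by choice. Uniqueness almost
  everywhere is what allows its norm to be computed from the classical gradient.\<close>

lemma is_weak_deriv_unique:
  fixes G G' :: "real^'d \<Rightarrow> real^'d^'d"
  assumes "is_weak_deriv f G" "is_weak_deriv f G'"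
  shows "AE x in torus_measure. G x = G' x"
proof -
  have G: "G \<in> borel_measurable borel" "integrable torus_measure (\<lambda>x. norm (G x))" if "is_weak_deriv f G" for G
    using that by (auto simp: is_weak_deriv_def Lp_def)
  have comp: "AE x in torus_measure. G x $ i $ j - G' x $ i $ j = 0" for i j
  proof -
    have m: "(\<lambda>x. G x $ i $ j) \<in> borel_measurable borel" if "is_weak_deriv f G" for G
    proof -
      have "(\<lambda>M::real^'d^'d. M $ i $ j) \<in> borel_measurable borel"
        by (intro borel_measurable_continuous_onI continuous_intros)
      from measurable_compose[OF G(1)[OF that] this] show ?thesis .
    qed
    have int: "integrable torus_measure (\<lambda>x. G x $ i $ j)" if "is_weak_deriv f G" for G
    proof (rule Bochner_Integration.integrable_bound[OF G(2)[OF that]])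
      have "\<bar>G x $ i $ j\<bar> \<le> norm (G x)" for x
        using component_le_norm_cart[of "G x $ i" j] Finite_Cartesian_Product.norm_nth_le[of "G x" i] by linarith
      then show "AE x in torus_measure. norm (G x $ i $ j) \<le> norm (norm (G x))" by simp
    qed (intro measurable_torus_measure m that)
    show ?thesis
    proof (rule fundamental_lemma_torus)
      show "(\<lambda>x. G x $ i $ j - G' x $ i $ j) \<in> borel_measurable borel"
        using m assms by simp
      show "integrable torus_measure (\<lambda>x. G x $ i $ j - G' x $ i $ j)"
        using int assms by simp
      fix \<phi> :: "real^'d \<Rightarrow> real" assume \<phi>: "test_function \<phi>"
      note td = test_function_differentiable[OF \<phi>]
      obtain C where C: "\<And>x. norm (\<phi> x) \<le> C"
        using continuous_periodic_bounded[OF td(2)] \<phi> by (auto simp: test_function_def)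
      have prod: "integrable torus_measure (\<lambda>x. G x $ i $ j * \<phi> x)" if "is_weak_deriv f G" for G
      proof (rule Bochner_Integration.integrable_bound)
        show "integrable torus_measure (\<lambda>x. C * G x $ i $ j)" using int[OF that] by simp
        show "(\<lambda>x. G x $ i $ j * \<phi> x) \<in> borel_measurable torus_measure"
          by (intro measurable_torus_measure borel_measurable_times m[OF that] borel_measurable_continuous_onI td(2))
        have "\<bar>\<phi> x\<bar> \<le> \<bar>C\<bar>" for x using C[of x] by simp
        then show "AE x in torus_measure. norm (G x $ i $ j * \<phi> x) \<le> norm (C * G x $ i $ j)"
          by (intro AE_I2) (auto simp: abs_mult mult.commute intro!: mult_right_mono)
      qed
      have "(LINT x|torus_measure. G x $ i $ j * \<phi> x) = (LINT x|torus_measure. G' x $ i $ j * \<phi> x)"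
      proof -
        have "(LINT x|torus_measure. f x $ i * partial j \<phi> x) = - (LINT x|torus_measure. G x $ i $ j * \<phi> x)"
          "(LINT x|torus_measure. f x $ i * partial j \<phi> x) = - (LINT x|torus_measure. G' x $ i $ j * \<phi> x)"
          using assms \<phi> by (simp_all add: is_weak_deriv_def)
        then show ?thesis by linarith
      qed
      then show "(LINT x|torus_measure. (G x $ i $ j - G' x $ i $ j) * \<phi> x) = 0"
        unfolding left_diff_distrib Bochner_Integration.integral_diff[OF prod[OF assms(1)] prod[OF assms(2)]]
        by simp
    qed
  qed
  have "AE x in torus_measure. \<forall>i\<in>UNIV. \<forall>j\<in>UNIV. G x $ i $ j - G' x $ i $ j = 0"
    by (intro AE_finite_allI comp) auto
  then show ?thesis by eventually_elim (simp add: vec_eq_iff)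
qed

lemma Lp_norm_nonneg: "Lp_norm p f \<ge> 0"
  by (simp add: Lp_norm_def)

text \<open>The cell has measure at most 1, so a uniform bound carries over without a
  constant.\<close>

lemma Lp_norm_le:
  fixes f :: "real^'d \<Rightarrow> 'b::euclidean_space"
  assumes f: "f \<in> borel_measurable borel" and le: "\<And>x. norm (f x) \<le> \<eta>" and p: "p > 0"
  shows "Lp_norm p f \<le> \<eta>"
proof -
  interpret finite_measure "torus_measure :: (real^'d) measure" by (rule finite_torus_measure)
  have \<eta>: "\<eta> \<ge> 0" using le[of 0] norm_ge_zero order_trans by blast
  have "(LINT x|torus_measure. norm (f x) powr p) \<le> (LINT x|(torus_measure :: (real^'d) measure). \<eta> powr p)"
    by (rule integral_mono[OF integrable_torus_bounded[where C="\<eta> powr p"]])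
       (use f le p in \<open>auto intro!: powr_mono2\<close>)
  also have "\<dots> = \<eta> powr p * measure torus_measure (cell :: (real^'d) set)" by simp
  also have "\<dots> \<le> \<eta> powr p" by (intro mult_left_le measure_torus_le_1) simp
  finally have "(LINT x|torus_measure. norm (f x) powr p) \<le> \<eta> powr p" .
  then have "Lp_norm p f \<le> (\<eta> powr p) powr (1 / p)"
    unfolding Lp_norm_def using p by (intro powr_mono2) (auto intro!: integral_nonneg_AE)
  also have "\<dots> = \<eta>" using \<eta> p by (simp add: powr_powr)
  finally show ?thesis .
qed

lemma Lp_norm_weak_deriv:
  assumes "is_weak_deriv f G"
  shows "Lp_norm p (weak_deriv f) = Lp_norm p G"
proof -
  have "is_weak_deriv f (weak_deriv f)"
    unfolding weak_deriv_def by (rule someI[of "is_weak_deriv f", OF assms])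
  from is_weak_deriv_unique[OF this assms]
  have "AE x in torus_measure. weak_deriv f x = G x" .
  moreover have "weak_deriv f \<in> borel_measurable borel" "G \<in> borel_measurable borel"
    using \<open>is_weak_deriv f (weak_deriv f)\<close> assms by (auto simp: is_weak_deriv_def Lp_def)
  ultimately show ?thesis
    unfolding Lp_norm_def
    by (intro arg_cong[where f="\<lambda>y. y powr (1 / p)"] integral_cong_AE)
       (auto intro!: measurable_torus_measure elim: eventually_mono)
qed

lemma is_weak_deriv_divergence_free:
  fixes f :: "real^'d \<Rightarrow> real^'d"
  assumes "is_weak_deriv f G" and tr: "\<And>x j. G x $ j $ j = 0" and cont: "continuous_on UNIV f"
  shows "divergence_free f"
  unfolding divergence_free_def
proof (intro allI impI)
  fix \<phi> :: "real^'d \<Rightarrow> real" assume \<phi>: "test_function \<phi>"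
  have "(LINT x|torus_measure. (\<Sum>j\<in>UNIV. f x $ j * partial j \<phi> x))
      = (\<Sum>j\<in>UNIV. LINT x|torus_measure. f x $ j * partial j \<phi> x)"
    by (intro Bochner_Integration.integral_sum integrable_torus_continuous continuous_intros cont
        test_function_differentiable(3)[OF \<phi>])
  also have "\<dots> = 0"
    using assms(1) \<phi> tr by (simp add: is_weak_deriv_def)
  finally show "(LINT x|torus_measure. (\<Sum>j\<in>UNIV. f x $ j * partial j \<phi> x)) = 0" .
qed

section \<open>A smoothed digit function\<close>

text \<open>On [0,1] this is the cubic 3x^2 - 2x^3, and the terms in x - 1 cancel its deviation from
  1 beyond that interval. Truncated powers give one formula for all x, differentiable at the break
  points as well.\<close>

definition sstep :: "real \<Rightarrow> real" where
  "sstep x = 3 * (max 0 x)^2 - 2 * (max 0 x)^3 + 3 * (max 0 (x - 1))^2 + 2 * (max 0 (x - 1))^3"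

definition sstep' :: "real \<Rightarrow> real" where
  "sstep' x = 6 * max 0 x - 6 * (max 0 x)^2 + 6 * max 0 (x - 1) + 6 * (max 0 (x - 1))^2"

text \<open>Only the break point needs an argument: an exponent of at least 2 makes the difference
  quotient there tend to 0.\<close>

lemma DERIV_max0_power:
  fixes x :: real
  shows "((\<lambda>x. (max 0 x) ^ Suc (Suc n)) has_real_derivative real (Suc (Suc n)) * (max 0 x) ^ Suc n) (at x)"
proof -
  consider "x < 0" | "x = 0" | "x > 0" by linarith
  then show ?thesis
  proof cases
    case 1
    have "((\<lambda>x::real. 0) has_real_derivative 0) (at x)" by simp
    then have "((\<lambda>x::real. (max 0 x) ^ Suc (Suc n)) has_real_derivative 0) (at x)"
      by (rule has_field_derivative_transform_within_open[of _ _ _ "{..<0}"]) (use 1 in auto)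
    then show ?thesis using 1 by simp
  next
    case 3
    have "((\<lambda>x::real. x ^ Suc (Suc n)) has_real_derivative real (Suc (Suc n)) * x ^ Suc n) (at x)"
      using DERIV_pow[of "Suc (Suc n)" x] by simp
    then have "((\<lambda>x::real. (max 0 x) ^ Suc (Suc n)) has_real_derivative real (Suc (Suc n)) * x ^ Suc n) (at x)"
      by (rule has_field_derivative_transform_within_open[of _ _ _ "{0<..}"]) (use 3 in auto)
    then show ?thesis using 3 by simp
  next
    case 2
    have "((\<lambda>h::real. (max 0 h) ^ Suc (Suc n) / h) \<longlongrightarrow> 0) (at 0)"
    proof (rule Lim_null_comparison)
      have "norm ((max 0 h) ^ Suc (Suc n) / h) \<le> \<bar>h\<bar> ^ Suc n" for h :: real
      proof (cases "h > 0")
        case False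
        then have "norm ((max 0 h) ^ Suc (Suc n) / h) = 0" by simp
        also have "0 \<le> \<bar>h\<bar> ^ Suc n" by (rule zero_le_power) simp
        finally show ?thesis .
      qed (auto simp: max_def)
      then show "\<forall>\<^sub>F h in at 0. norm ((max 0 h) ^ Suc (Suc n) / h) \<le> \<bar>h::real\<bar> ^ Suc n"
        by (intro always_eventually allI)
      have "((\<lambda>h::real. \<bar>h\<bar> ^ Suc n) \<longlongrightarrow> \<bar>0\<bar> ^ Suc n) (at 0)"
        by (rule tendsto_power[OF tendsto_rabs[OF tendsto_ident_at]])
      then show "((\<lambda>h::real. \<bar>h\<bar> ^ Suc n) \<longlongrightarrow> 0) (at 0)" by simp
    qed
    then show ?thesis unfolding 2 DERIV_def by simp
  qed
qed

lemma sstep_deriv: "(sstep has_real_derivative sstep' x) (at x)"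
proof -
  have *: "((\<lambda>x::real. (max 0 x) ^ 2) has_real_derivative 2 * max 0 x) (at x)"
    "((\<lambda>x::real. (max 0 x) ^ 3) has_real_derivative 3 * (max 0 x)^2) (at x)" for x
    using DERIV_max0_power[of 0 x] DERIV_max0_power[of 1 x] by (simp_all add: numeral_eq_Suc)
  have 1: "((\<lambda>x::real. (max 0 (x - 1)) ^ 2) has_real_derivative 2 * max 0 (x - 1)) (at x)"
    using DERIV_shift[of "\<lambda>x. (max 0 x)^2" _ x "-1"] *(1)[of "x - 1"] by simp
  have 2: "((\<lambda>x::real. (max 0 (x - 1)) ^ 3) has_real_derivative 3 * (max 0 (x - 1))^2) (at x)"
    using DERIV_shift[of "\<lambda>x. (max 0 x)^3" _ x "-1"] *(2)[of "x - 1"] by simp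
  show ?thesis
    unfolding sstep_def sstep'_def
    by (rule derivative_eq_intros * 1 2 refl | simp)+
qed

lemma continuous_sstep': "continuous_on S sstep'"
  unfolding sstep'_def by (intro continuous_intros)

lemma sstep_0: "x \<le> 0 \<Longrightarrow> sstep x = 0"
  by (simp add: sstep_def max_def)

lemma sstep_1: "x \<ge> 1 \<Longrightarrow> sstep x = 1"
  by (simp add: sstep_def max_def power2_eq_square power3_eq_cube algebra_simps)

lemma sstep'_0: "x \<le> 0 \<or> x \<ge> 1 \<Longrightarrow> sstep' x = 0"
  by (auto simp: sstep'_def max_def power2_eq_square algebra_simps)

lemma sstep_bounds: "0 \<le> sstep x" "sstep x \<le> 1"
proof -
  have "0 \<le> sstep x \<and> sstep x \<le> 1"
  proof -
    consider "x \<le> 0" | "0 \<le> x" "x \<le> 1" | "x \<ge> 1" by linarith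
    then show ?thesis
    proof cases
      case 2
      have eq: "sstep x = x^2 * (3 - 2 * x)" "1 - sstep x = (1 - x)^2 * (1 + 2 * x)"
        using 2 by (auto simp: sstep_def max_def power2_eq_square power3_eq_cube algebra_simps)
      have "0 \<le> x^2 * (3 - 2 * x)" "0 \<le> (1 - x)^2 * (1 + 2 * x)" using 2 by auto
      then show ?thesis using eq by linarith
    qed (auto simp: sstep_0 sstep_1)
  qed
  then show "0 \<le> sstep x" "sstep x \<le> 1" by auto
qed

lemma sstep'_bound: "\<bar>sstep' x\<bar> \<le> 2"
proof (cases "0 \<le> x \<and> x \<le> 1")
  case True
  then have eq: "sstep' x = 6 * x * (1 - x)"
    by (auto simp: sstep'_def max_def power2_eq_square algebra_simps)
  have "0 \<le> (2 * x - 1)^2" by simp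
  then have "6 * x * (1 - x) \<le> 2" by (simp add: power2_eq_square algebra_simps)
  moreover have "0 \<le> 6 * x * (1 - x)" using True by auto
  ultimately show ?thesis by (simp add: eq)
qed (use sstep'_0 in auto)

lemma sstep_lipschitz: "\<bar>sstep x - sstep y\<bar> \<le> 2 * \<bar>x - y\<bar>"
proof -
  have "norm (sstep x - sstep y) \<le> 2 * norm (x - y)"
    by (rule field_differentiable_bound[of UNIV _ sstep'])
       (simp_all add: sstep_deriv sstep'_bound)
  then show ?thesis by simp
qed

section \<open>Smoothed digits modulo b\<close>

definition gap :: "nat \<Rightarrow> real \<Rightarrow> real" where
  "gap b \<delta> = cos (pi * (1 - 2 * \<delta>) / b) - cos (pi / b)"

text \<open>On the circle of length b the cosine centred at a + 1/2 exceeds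
  \<open>cos (pi / b)\<close> exactly on the open interval (a, a + 1), and exceeds it by at least
  \<open>gap b \<delta>\<close> at distance \<delta> or more from the ends. After division by
  \<open>gap b \<delta>\<close>, \<open>sstep\<close> turns it into a bump that is 1 inside these
  margins and 0 off the interval. The cosine builds in the period b, so nothing has to be
  glued.\<close>

definition digit :: "nat \<Rightarrow> real \<Rightarrow> real \<Rightarrow> real" where
  "digit b \<delta> z = (\<Sum>a<b. real a * sstep ((cos (2 * pi * (z - real a - 1/2) / b) - cos (pi / b)) / gap b \<delta>))"

definition digit' :: "nat \<Rightarrow> real \<Rightarrow> real \<Rightarrow> real" where
  "digit' b \<delta> z = (\<Sum>a<b. real a * (sstep' ((cos (2 * pi * (z - real a - 1/2) / b) - cos (pi / b)) / gap b \<delta>)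
     * (- sin (2 * pi * (z - real a - 1/2) / b) * (2 * pi / b) / gap b \<delta>)))"

lemma digit_deriv: "(digit b \<delta> has_real_derivative digit' b \<delta> z) (at z)"
proof -
  have "((\<lambda>z. sstep ((cos (2 * pi * (z - a - 1/2) / b) - cos (pi / b)) / gap b \<delta>)) has_real_derivative
     sstep' ((cos (2 * pi * (z - a - 1/2) / b) - cos (pi / b)) / gap b \<delta>)
     * (- sin (2 * pi * (z - a - 1/2) / b) * (2 * pi / b) / gap b \<delta>)) (at z)" for a
  proof (rule DERIV_chain2[OF sstep_deriv])
    have "((\<lambda>z. 2 * pi * (z - a - 1/2) / b) has_real_derivative 2 * pi / b) (at z)"
      unfolding divide_inverse by (rule derivative_eq_intros refl | simp)+
    from DERIV_chain2[OF DERIV_cos this]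
    have "((\<lambda>z. cos (2 * pi * (z - a - 1/2) / b)) has_real_derivative
        - sin (2 * pi * (z - a - 1/2) / b) * (2 * pi / b)) (at z)" .
    from DERIV_cdivide[OF DERIV_diff[OF this DERIV_const], of "cos (pi / b)" "gap b \<delta>"]
    show "((\<lambda>z. (cos (2 * pi * (z - a - 1/2) / b) - cos (pi / b)) / gap b \<delta>) has_real_derivative
        - sin (2 * pi * (z - a - 1/2) / b) * (2 * pi / b) / gap b \<delta>) (at z)" by simp
  qed
  then show ?thesis
    unfolding digit_def digit'_def by (intro DERIV_sum DERIV_cmult)
qed

lemma continuous_on_sstep'_comp [continuous_intros]:
  "continuous_on S f \<Longrightarrow> continuous_on S (\<lambda>x. sstep' (f x))"
  using continuous_on_compose2[OF continuous_sstep'[of UNIV], of S f] by simp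

lemma continuous_digit': "continuous_on S (digit' b \<delta>)"
  unfolding digit'_def divide_inverse by (intro continuous_intros)

lemma digit_bounds: "0 \<le> digit b \<delta> z" "digit b \<delta> z \<le> b^2"
proof -
  show "0 \<le> digit b \<delta> z"
    unfolding digit_def by (intro sum_nonneg mult_nonneg_nonneg sstep_bounds) auto
  have "digit b \<delta> z \<le> (\<Sum>(a::nat)<b. real b * 1)"
    unfolding digit_def by (intro sum_mono mult_mono sstep_bounds) (auto intro: less_imp_le)
  then show "digit b \<delta> z \<le> b^2" by (simp add: power2_eq_square)
qed

lemma cos_add_period: "b > 0 \<Longrightarrow> cos (2 * pi * (z + real b * of_int q) / b) = cos (2 * pi * z / b)"
proof -
  assume "b > 0"
  then have "2 * pi * (z + real b * of_int q) / b = 2 * pi * z / b + 2 * pi * of_int q"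
    by (simp add: field_simps)
  then show ?thesis using cos_int_2pin[of q] sin_int_2pin[of q] by (simp add: cos_add)
qed

lemma digit_periodic: "b > 0 \<Longrightarrow> digit b \<delta> (z + real b * of_int q) = digit b \<delta> z"
proof -
  assume b: "b > 0"
  have "cos (2 * pi * (z + real b * of_int q - a - 1/2) / b) = cos (2 * pi * (z - a - 1/2) / b)" for a
    using cos_add_period[OF b, of "z - a - 1/2" q] by (simp add: algebra_simps)
  then show ?thesis by (simp add: digit_def)
qed

lemma digit'_periodic: "b > 0 \<Longrightarrow> digit' b \<delta> (z + real b * of_int q) = digit' b \<delta> z"
proof -
  assume b: "b > 0"
  have "(digit b \<delta> has_real_derivative digit' b \<delta> (z + real b * of_int q)) (at (z + real b * of_int q))"
    by (rule digit_deriv)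
  then have "((\<lambda>z. digit b \<delta> (z + real b * of_int q)) has_real_derivative digit' b \<delta> (z + real b * of_int q)) (at z)"
    by (subst (asm) DERIV_shift) 
  then have "(digit b \<delta> has_real_derivative digit' b \<delta> (z + real b * of_int q)) (at z)"
    by (simp add: digit_periodic[OF b])
  then show ?thesis using digit_deriv DERIV_unique by blast
qed

lemma cos_le_cos:
  assumes "0 \<le> t" "t \<le> pi" "t \<le> \<bar>y\<bar>" "\<bar>y\<bar> \<le> 2 * pi - t"
  shows "cos y \<le> cos t"
proof (cases "\<bar>y\<bar> \<le> pi")
  case True
  have "cos \<bar>y\<bar> \<le> cos t" using assms True by (intro cos_monotone_0_pi_le) auto
  then show ?thesis by simp
next
  case False
  have "cos (2 * pi - \<bar>y\<bar>) \<le> cos t" using assms False by (intro cos_monotone_0_pi_le) auto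
  then show ?thesis by (simp add: cos_diff)
qed

lemma digit_eq:
  assumes b: "b \<ge> 2" and \<delta>: "0 < \<delta>" "\<delta> < 1/2" and fr: "\<delta> \<le> frac z" "frac z \<le> 1 - \<delta>"
  shows "digit b \<delta> z = of_int (\<lfloor>z\<rfloor> mod int b)"
proof -
  define k where "k = \<lfloor>z\<rfloor> mod int b"
  define q where "q = \<lfloor>z\<rfloor> div int b"
  have k: "0 \<le> k" "k < int b" using b by (auto simp: k_def)
  have z: "z = of_int k + frac z + real b * of_int q"
  proof -
    have "of_int \<lfloor>z\<rfloor> = real_of_int (int b * q + k)" by (simp add: k_def q_def)
    then show ?thesis by (simp add: frac_def)
  qed
  have gap: "gap b \<delta> > 0"
  proof -
    have "cos (pi / b) < cos (pi * (1 - 2 * \<delta>) / b)"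
      using b \<delta> by (intro cos_monotone_0_pi) (auto simp: field_simps)
    then show ?thesis by (simp add: gap_def)
  qed
  have step: "sstep ((cos (2 * pi * (z - a - 1/2) / b) - cos (pi / b)) / gap b \<delta>)
      = (if int a = k then 1 else 0)" if a: "a < b" for a
  proof -
    \<comment> \<open>The offset of \<open>z\<close> from the centre of the interval of digit
      \<open>a\<close>, up to a multiple of the period: at most 1/2 - \<delta> in size if
      \<open>a\<close> is the digit of \<open>z\<close>, and between 1/2 and b - 1/2
      otherwise.\<close>
    define y where "y = of_int (k - int a) + frac z - 1/2"
    have "z - a - 1/2 = y + real b * of_int q" using z by (simp add: y_def)
    then have c: "cos (2 * pi * (z - a - 1/2) / b) = cos (2 * pi * y / b)"
      using cos_add_period[of b y q] b by simp
    show ?thesis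
    proof (cases "int a = k")
      case True
      then have "\<bar>y\<bar> \<le> 1/2 - \<delta>" using fr by (auto simp: y_def)
      then have "2 * pi * \<bar>y\<bar> \<le> 2 * pi * (1/2 - \<delta>)" by (intro mult_left_mono) auto
      then have "\<bar>2 * pi * y / b\<bar> \<le> pi * (1 - 2 * \<delta>) / b"
        using b by (simp add: abs_mult field_simps)
      moreover have "pi * (1 - 2 * \<delta>) / b \<le> pi"
      proof -
        have "pi * (1 - 2 * \<delta>) \<le> pi * b" using b \<delta> by (intro mult_left_mono) auto
        then show ?thesis using b by (simp add: field_simps)
      qed
      ultimately have "cos (pi * (1 - 2 * \<delta>) / b) \<le> cos \<bar>2 * pi * y / b\<bar>"
        by (intro cos_monotone_0_pi_le) auto
      then have "cos (pi * (1 - 2 * \<delta>) / b) \<le> cos (2 * pi * y / b)" by (simp only: cos_abs_real)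
      then have "(cos (2 * pi * y / b) - cos (pi / b)) / gap b \<delta> \<ge> 1"
        using gap by (simp add: gap_def)
      then show ?thesis using True c by (simp add: sstep_1)
    next
      case False
      have "1/2 \<le> \<bar>y\<bar>" "\<bar>y\<bar> \<le> b - 1/2"
      proof -
        have "k - int a \<ge> 1 \<and> k - int a \<le> int b - 1 \<or> k - int a \<le> -1 \<and> k - int a \<ge> 1 - int b"
          using False k a by auto
        then have "(real_of_int (k - int a) \<ge> 1 \<and> real_of_int (k - int a) \<le> b - 1) \<or>
            (real_of_int (k - int a) \<le> -1 \<and> real_of_int (k - int a) \<ge> 1 - real b)" by linarith
        then show "1/2 \<le> \<bar>y\<bar>" "\<bar>y\<bar> \<le> b - 1/2"
          using fr \<delta> unfolding y_def by linarith+
      qed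
      then have "pi * (1/2) \<le> pi * \<bar>y\<bar>" "pi * \<bar>y\<bar> \<le> pi * (b - 1/2)" by (auto intro: mult_left_mono)
      then have "cos (2 * pi * y / b) \<le> cos (pi / b)"
        using b by (intro cos_le_cos) (auto simp: abs_mult field_simps)
      then have "(cos (2 * pi * y / b) - cos (pi / b)) / gap b \<delta> \<le> 0"
        using gap by (simp add: divide_nonpos_pos)
      then show ?thesis using False c by (simp add: sstep_0)
    qed
  qed
  have "digit b \<delta> z = (\<Sum>a<b. real a * (if int a = k then 1 else 0))"
    unfolding digit_def by (intro sum.cong refl) (auto simp: step)
  also have "\<dots> = (\<Sum>a<b. if a = nat k then real a else 0)"
    using k by (intro sum.cong refl) auto
  also have "\<dots> = of_int k" using k by simp
  finally show ?thesis by (simp add: k_def)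
qed

section \<open>Shears\<close>

definition shear :: "'d \<Rightarrow> 'd \<Rightarrow> (real \<Rightarrow> real) \<Rightarrow> real^'d \<Rightarrow> real^'d" where
  "shear c j g p = p + g (p $ j) *\<^sub>R axis c 1"

lemma shear_nth: "shear c j g p $ i = (if i = c then p $ i + g (p $ j) else p $ i)"
  by (simp add: shear_def axis_def)

lemma shear_inverse: "j \<noteq> c \<Longrightarrow> shear c j g (shear c j (\<lambda>z. - g z) p) = p"
  by (simp add: vec_eq_iff shear_nth)

lemma shear_inverse': "j \<noteq> c \<Longrightarrow> shear c j (\<lambda>z. - g z) (shear c j g p) = p"
  by (simp add: vec_eq_iff shear_nth)

lemma shear_vimage: "j \<noteq> c \<Longrightarrow> shear c j g -` W = shear c j (\<lambda>z. - g z) ` W"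
  by (auto simp: shear_inverse image_iff) (metis shear_inverse')

lemma shear_deriv:
  assumes "\<And>z. (g has_real_derivative g' z) (at z)"
  shows "(shear c j g has_derivative (\<lambda>h. h + (g' (p $ j) * h $ j) *\<^sub>R axis c 1)) (at p)"
proof -
  have "((\<lambda>p. p $ j) has_derivative (\<lambda>h. h $ j)) (at p)"
    by (rule bounded_linear_imp_has_derivative[OF bounded_linear_vec_nth])
  from has_derivative_compose[OF this] assms[of "p $ j"]
  have "((\<lambda>p. g (p $ j)) has_derivative (\<lambda>h. g' (p $ j) * h $ j)) (at p)"
    by (simp add: has_field_derivative_def)
  then show ?thesis
    unfolding shear_def by (intro derivative_intros)
qed

lemma tendsto_floor_mult_div:
  "(\<lambda>m. of_int \<lfloor>real (Suc m) * z\<rfloor> / real (Suc m)) \<longlonglongrightarrow> (z::real)"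
proof (rule LIM_zero_cancel, rule Lim_null_comparison)
  show "(\<lambda>m. 1 / real (Suc m)) \<longlonglongrightarrow> 0" by (rule LIMSEQ_Suc[OF lim_1_over_n])
  have "norm (of_int \<lfloor>real (Suc m) * z\<rfloor> / real (Suc m) - z) \<le> 1 / real (Suc m)" for m
  proof -
    have "\<bar>of_int \<lfloor>real (Suc m) * z\<rfloor> - real (Suc m) * z\<bar> \<le> 1" by linarith
    then have "\<bar>of_int \<lfloor>real (Suc m) * z\<rfloor> - real (Suc m) * z\<bar> / real (Suc m) \<le> 1 / real (Suc m)"
      by (rule divide_right_mono) simp
    moreover have "of_int \<lfloor>real (Suc m) * z\<rfloor> / real (Suc m) - z
        = (of_int \<lfloor>real (Suc m) * z\<rfloor> - real (Suc m) * z) / real (Suc m)"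
      by (simp add: diff_divide_distrib)
    ultimately show ?thesis by (simp only: real_norm_def abs_divide abs_of_nat)
  qed
  then show "\<forall>\<^sub>F m in sequentially. norm (of_int \<lfloor>real (Suc m) * z\<rfloor> / real (Suc m) - z) \<le> 1 / real (Suc m)"
    by (intro always_eventually allI)
qed

text \<open>Shears whose profile is a step function are piecewise translations, hence preserve Lebesgue
  measure; a continuous profile is a limit of such.\<close>

lemma emeasure_shear_vimage_step:
  fixes U :: "(real^'d) set"
  assumes j: "j \<noteq> c" and U[measurable]: "U \<in> sets borel"
  shows "emeasure lborel (shear c j (\<lambda>z. g \<lfloor>m * z\<rfloor>) -` U) = emeasure lborel U"
proof -
  define A where "A k = {p::real^'d. \<lfloor>m * p $ j\<rfloor> = k}" for k
  have [measurable]: "A k \<in> sets borel" for k unfolding A_def by measurable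
  define v :: "int \<Rightarrow> real^'d" where "v k = g k *\<^sub>R axis c 1" for k
  have pre: "(+) (v k) -` (A k \<inter> U) \<in> sets borel" for k
    by (rule measurable_sets_borel[of "(+) (v k)" borel]) measurable
  have disj: "disjoint_family_on (\<lambda>k. (+) (v k) -` (A k \<inter> U)) UNIV" "disjoint_family_on (\<lambda>k. A k \<inter> U) UNIV"
    using j by (auto simp: disjoint_family_on_def A_def v_def axis_def)
  have eq: "emeasure lborel ((+) (v k) -` (A k \<inter> U)) = emeasure lborel (A k \<inter> U)" for k
  proof -
    have "emeasure lborel (A k \<inter> U) = emeasure (distr lborel borel ((+) (v k))) (A k \<inter> U)"
      by (simp add: lborel_distr_plus)
    also have "\<dots> = emeasure lborel ((+) (v k) -` (A k \<inter> U))"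
      by (subst emeasure_distr) auto
    finally show ?thesis by simp
  qed
  have "shear c j (\<lambda>z. g \<lfloor>m * z\<rfloor>) -` U = (\<Union>k. (+) (v k) -` (A k \<inter> U))"
    using j by (auto simp: A_def v_def axis_def shear_def add.commute)
  also have "emeasure lborel \<dots> = (\<integral>\<^sup>+k. emeasure lborel ((+) (v k) -` (A k \<inter> U)) \<partial>count_space UNIV)"
    by (rule emeasure_UN_countable) (use pre disj in auto)
  also have "\<dots> = (\<integral>\<^sup>+k. emeasure lborel (A k \<inter> U) \<partial>count_space UNIV)" by (simp only: eq)
  also have "\<dots> = emeasure lborel (\<Union>k. A k \<inter> U)"
    by (rule emeasure_UN_countable[symmetric]) (use disj in auto)
  also have "(\<Union>k. A k \<inter> U) = U" by (auto simp: A_def)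
  finally show ?thesis .
qed

lemma emeasure_shear_vimage_le:
  fixes U :: "(real^'d) set"
  assumes g: "continuous_on UNIV g" and j: "j \<noteq> c" and U: "open U"
  shows "emeasure lborel (shear c j g -` U) \<le> emeasure lborel U"
proof -
  define h where "h m = shear c j (\<lambda>z. g (of_int \<lfloor>real (Suc m) * z\<rfloor> / real (Suc m)))" for m
  have [measurable]: "g \<in> borel_measurable borel" using g by (rule borel_measurable_continuous_onI)
  have [measurable]: "U \<in> sets borel" using U by simp
  have [measurable]: "h m \<in> borel_measurable borel" for m
    unfolding h_def shear_def by measurable
  have [measurable]: "shear c j g \<in> borel_measurable borel"
    unfolding shear_def by measurable
  have pre: "shear c j g -` U \<in> sets borel" "h m -` U \<in> sets borel" for m
    by (rule measurable_sets_borel[of _ borel]; measurable)+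
  have lim: "(\<lambda>m. h m p) \<longlonglongrightarrow> shear c j g p" for p
  proof -
    have "isCont g (p $ j)" using g by (simp add: continuous_on_eq_continuous_at)
    from isCont_tendsto_compose[OF this tendsto_floor_mult_div]
    show ?thesis unfolding h_def shear_def by (intro tendsto_intros)
  qed
  \<comment> \<open>Membership in an open set persists along a convergent sequence from some index
    on. This makes Fatou applicable, and it yields only an inequality, for open
    \<open>U\<close>.\<close>
  have ind: "indicator (shear c j g -` U) p \<le> liminf (\<lambda>m. indicator (h m -` U) p :: ennreal)" for p
  proof (cases "shear c j g p \<in> U")
    case True
    then have "eventually (\<lambda>m. h m p \<in> U) sequentially"
      using topological_tendstoD[OF lim U] by blast
    then have "1 \<le> liminf (\<lambda>m. indicator (h m -` U) p :: ennreal)"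
      by (intro Liminf_bounded) (auto elim!: eventually_mono)
    then show ?thesis using True by simp
  qed simp
  have "emeasure lborel (shear c j g -` U) = (\<integral>\<^sup>+p. indicator (shear c j g -` U) p \<partial>lborel)"
    using pre by simp
  also have "\<dots> \<le> (\<integral>\<^sup>+p. liminf (\<lambda>m. indicator (h m -` U) p) \<partial>lborel)"
    by (intro nn_integral_mono ind)
  also have "\<dots> \<le> liminf (\<lambda>m. \<integral>\<^sup>+p. indicator (h m -` U) p \<partial>lborel)"
    by (rule nn_integral_liminf) (use pre in auto)
  also have "\<dots> = liminf (\<lambda>m. emeasure lborel U)"
  proof -
    have "(\<integral>\<^sup>+p. indicator (h m -` U) p \<partial>lborel) = emeasure lborel (h m -` U)" for m
      using pre by simp
    also have "emeasure lborel (h m -` U) = emeasure lborel U" for m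
      unfolding h_def by (rule emeasure_shear_vimage_step[OF j, of U "\<lambda>k. g (of_int k / real (Suc m))"]) simp
    finally show ?thesis by simp
  qed
  also have "\<dots> = emeasure lborel U" by (simp add: Liminf_const)
  finally show ?thesis .
qed

text \<open>The preimage is the image under the inverse shear, and differentiable maps of a space
  into itself send null sets to null sets.\<close>

lemma negligible_shear_vimage:
  fixes W :: "(real^'d) set"
  assumes g: "\<And>z. (g has_real_derivative g' z) (at z)" and j: "j \<noteq> c" and W: "negligible W"
  shows "negligible (shear c j g -` W)"
  unfolding shear_vimage[OF j]
proof (rule negligible_differentiable_image_negligible[OF order_refl W])
  have "(shear c j (\<lambda>z. - g z) has_derivative (\<lambda>h. h + (- g' (p $ j) * h $ j) *\<^sub>R axis c 1)) (at p)" for p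
    using shear_deriv[OF DERIV_minus[OF g], where c=c and j=j and p=p] .
  then show "shear c j (\<lambda>z. - g z) differentiable_on W"
    unfolding differentiable_on_def differentiable_def using has_derivative_at_withinI by blast
qed

section \<open>The vector field and its flow\<close>

lemma absolutely_continuous_curve_Lipschitz:
  fixes \<gamma> :: "real \<Rightarrow> 'b::real_normed_vector"
  assumes L: "\<And>s t. norm (\<gamma> t - \<gamma> s) \<le> L * \<bar>t - s\<bar>"
  shows "absolutely_continuous_curve \<gamma>"
  unfolding absolutely_continuous_curve_def
proof (intro allI impI)
  fix \<epsilon> :: real assume \<epsilon>: "\<epsilon> > 0"
  show "\<exists>\<delta>>0. \<forall>n (a :: nat \<Rightarrow> real) b. (\<forall>i<n. 0 \<le> a i \<and> a i \<le> b i \<and> b i \<le> 1) \<longrightarrow>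
      disjoint_family_on (\<lambda>i. {a i<..<b i}) {..<n} \<longrightarrow> (\<Sum>i<n. b i - a i) < \<delta> \<longrightarrow>
      (\<Sum>i<n. norm (\<gamma> (b i) - \<gamma> (a i))) < \<epsilon>"
  proof (intro exI[of _ "\<epsilon> / (\<bar>L\<bar> + 1)"] conjI allI impI)
    fix n :: nat and a b :: "nat \<Rightarrow> real"
    assume ab: "\<forall>i<n. 0 \<le> a i \<and> a i \<le> b i \<and> b i \<le> 1" and lt: "(\<Sum>i<n. b i - a i) < \<epsilon> / (\<bar>L\<bar> + 1)"
    have "(\<Sum>i<n. norm (\<gamma> (b i) - \<gamma> (a i))) \<le> (\<Sum>i<n. (\<bar>L\<bar> + 1) * (b i - a i))"
    proof (rule sum_mono)
      fix i assume "i \<in> {..<n}"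
      then have "norm (\<gamma> (b i) - \<gamma> (a i)) \<le> L * (b i - a i)" using L[of "b i" "a i"] ab by auto
      also have "\<dots> \<le> (\<bar>L\<bar> + 1) * (b i - a i)" using ab \<open>i \<in> {..<n}\<close> by (intro mult_right_mono) auto
      finally show "norm (\<gamma> (b i) - \<gamma> (a i)) \<le> (\<bar>L\<bar> + 1) * (b i - a i)" .
    qed
    also have "\<dots> = (\<bar>L\<bar> + 1) * (\<Sum>i<n. b i - a i)" by (simp add: sum_distrib_left)
    also have "\<dots> < \<epsilon>" using lt by (simp add: field_simps add_pos_nonneg)
    finally show "(\<Sum>i<n. norm (\<gamma> (b i) - \<gamma> (a i))) < \<epsilon>" .
  qed (use \<epsilon> in \<open>simp add: add_nonneg_pos\<close>)
qed

locale branching =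
  fixes b :: nat and e0 e1 :: "'d::finite"
  assumes b2: "b \<ge> 2" and e01: "e0 \<noteq> e1"
begin

text \<open>The factor b makes the digit functions 1-periodic, the factor 4 makes displacements
  decay like 4^-n, and the square in the exponent makes the ratio of successive scales grow fast
  enough for \<open>Q_growth\<close>.\<close>

definition Q :: "nat \<Rightarrow> nat" where "Q n = (4 * b) ^ ((n + 1)^2)"

text \<open>The sum of the geometric series that dominates the later displacements in
  \<open>pos_coord\<close>; summable in n, as Borel-Cantelli requires.\<close>

definition dl :: "nat \<Rightarrow> real" where "dl n = (1/2) ^ (n + 3)"

definition ax :: "nat \<Rightarrow> 'd" where "ax n = (if even n then e0 else e1)"

text \<open>The sign is negative because the field acts forwards in time; \<open>P\<close> runs the
  stages backwards and so adds the digit.\<close>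

definition prof :: "nat \<Rightarrow> real \<Rightarrow> real" where
  "prof n z = - digit b (dl (Suc n)) (real (Q (Suc n)) * z) / real (Q n)"

definition prof' :: "nat \<Rightarrow> real \<Rightarrow> real" where
  "prof' n z = - (digit' b (dl (Suc n)) (real (Q (Suc n)) * z) * real (Q (Suc n))) / real (Q n)"

definition f :: "nat \<Rightarrow> real^'d \<Rightarrow> real^'d" where
  "f n x = prof n (x $ ax (Suc n)) *\<^sub>R axis (ax n) 1"

text \<open>The position at time 2^-(n+1) of the trajectory that rests at \<open>z\<close> from time
  1/2 on; see \<open>Phi_grid\<close>.\<close>

fun P :: "nat \<Rightarrow> real^'d \<Rightarrow> real^'d" where
  "P 0 z = z"
| "P (Suc n) z = P n z - f n (P n z)"

definition th :: "nat \<Rightarrow> real \<Rightarrow> real" where "th n t = sstep (4 * 2^n * t - 1)"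

definition ch :: "nat \<Rightarrow> real \<Rightarrow> real" where "ch n t = 4 * 2^n * sstep' (4 * 2^n * t - 1)"

text \<open>At every time at most one summand is nonzero, since \<open>ch n\<close> vanishes off the
  interval of stage n.\<close>

definition u :: "real \<times> (real^'d) \<Rightarrow> real^'d" where
  "u p = (\<Sum>n. ch n (fst p) *\<^sub>R f n (snd p))"

text \<open>The flow in closed form, labelled by the late position \<open>z\<close>: during stage n
  the trajectory moves on a straight segment, and at time \<open>t\<close> the fraction
  \<open>1 - th n t\<close> of the shear has been undone.\<close>

definition Phi :: "real \<Rightarrow> real^'d \<Rightarrow> real^'d" where
  "Phi t z = z - (\<Sum>n. (1 - th n t) *\<^sub>R f n (P n z))"

section \<open>Scales, displacements and time cut-offs\<close>

lemma ax_neq: "ax (Suc n) \<noteq> ax n" "ax n \<noteq> ax (Suc n)"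
  using e01 by (auto simp: ax_def)

lemma Q_pos [simp]: "Q n > 0" "real (Q n) > 0" "Q n \<noteq> 0"
  using b2 by (auto simp: Q_def)

lemma b_dvd_Q: "b dvd Q n"
proof -
  have "b dvd 4 * b" by simp
  also have "4 * b dvd (4 * b) ^ ((n + 1)^2)" by (rule dvd_power) simp
  finally show ?thesis by (simp only: Q_def)
qed

text \<open>The squares in the exponents differ by at least k + 2, which pays for the factor on the
  left. A displacement of at most b / \<open>Q k\<close> is therefore at most 2^-(k+2) cells of
  stage n.\<close>

lemma Q_growth: "n < k \<Longrightarrow> real b * 2 ^ (k + 2) * real (Q n) \<le> real (Q k)"
proof -
  assume "n < k"
  then obtain m where k: "k = Suc (n + m)" using less_imp_Suc_add by blast
  have "(n + 1)^2 + (k + 2) \<le> (k + 1)^2"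
    unfolding k by (simp add: power2_eq_square algebra_simps)
  then have "(4 * b) ^ ((n + 1)^2 + (k + 2)) \<le> Q k"
    unfolding Q_def using b2 by (intro power_increasing) auto
  moreover have "b * 2 ^ (k + 2) \<le> (4 * b) ^ (k + 2)"
  proof -
    have "b * 2 ^ (k + 2) \<le> b ^ (k + 2) * 4 ^ (k + 2)"
      using b2 by (intro mult_mono self_le_power power_mono) auto
    then show ?thesis by (simp add: power_mult_distrib mult.commute)
  qed
  then have "(b * 2 ^ (k + 2)) * Q n \<le> (4 * b) ^ (k + 2) * Q n" by (rule mult_right_mono) simp
  then have "(b * 2 ^ (k + 2)) * Q n \<le> (4 * b) ^ ((n + 1)^2 + (k + 2))"
    by (simp add: Q_def power_add mult.commute)
  ultimately have "b * 2 ^ (k + 2) * Q n \<le> Q k" by linarith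
  then have "real (b * 2 ^ (k + 2) * Q n) \<le> real (Q k)" by (simp only: of_nat_le_iff)
  then show ?thesis by simp
qed

lemma Q_lower: "real b * 4 ^ n \<le> real (Q n)"
proof -
  have "b * 4 ^ n \<le> b ^ (n + 1) * 4 ^ (n + 1)"
    using b2 by (intro mult_mono self_le_power power_increasing) auto
  also have "\<dots> = (4 * b) ^ (n + 1)" by (simp add: power_mult_distrib mult.commute)
  also have "\<dots> \<le> Q n"
    unfolding Q_def using b2 by (intro power_increasing) (auto simp: power2_eq_square)
  finally have "real (b * 4 ^ n) \<le> real (Q n)" by (simp only: of_nat_le_iff)
  then show ?thesis by simp
qed

lemma norm_f_le: "norm (f n x) \<le> b * (1/4)^n"
proof -
  have "norm (f n x) = digit b (dl (Suc n)) (real (Q (Suc n)) * (x $ ax (Suc n))) / Q n"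
    using digit_bounds(1)[of b "dl (Suc n)"] by (simp add: f_def prof_def)
  also have "\<dots> \<le> b^2 / Q n" by (intro divide_right_mono digit_bounds) auto
  also have "\<dots> \<le> b^2 / (real b * 4 ^ n)"
    using b2 Q_lower[of n] by (intro divide_left_mono mult_pos_pos) auto
  also have "\<dots> = b * (1/4)^n" using b2 by (simp add: power2_eq_square power_divide)
  finally show ?thesis .
qed

lemma th_0: "4 * 2^n * t \<le> 1 \<Longrightarrow> th n t = 0"
  by (simp add: th_def sstep_0)

lemma th_1: "2 * 2^n * t \<ge> 1 \<Longrightarrow> th n t = 1"
  unfolding th_def by (rule sstep_1) linarith

lemma ch_0: "4 * 2^n * t \<le> 1 \<or> 2 * 2^n * t \<ge> 1 \<Longrightarrow> ch n t = 0"
proof -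
  assume "4 * 2^n * t \<le> 1 \<or> 2 * 2^n * t \<ge> 1"
  then have "4 * 2^n * t - 1 \<le> 0 \<or> 4 * 2^n * t - 1 \<ge> 1" by linarith
  then show ?thesis unfolding ch_def by (simp add: sstep'_0)
qed

lemma th_bounds: "0 \<le> th n t" "th n t \<le> 1"
  by (simp_all add: th_def sstep_bounds)

lemma th_deriv: "(th n has_real_derivative ch n t) (at t)"
proof -
  have "((\<lambda>t. 4 * 2^n * t - 1) has_real_derivative 4 * 2^n) (at t)"
    by (auto intro!: derivative_eq_intros)
  from DERIV_chain2[OF sstep_deriv this]
  have "((\<lambda>t. sstep (4 * 2^n * t - 1)) has_real_derivative sstep' (4 * 2^n * t - 1) * (4 * 2^n)) (at t)" .
  then show ?thesis by (simp add: th_def[abs_def] ch_def mult.commute)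
qed

lemma continuous_ch: "continuous_on A (ch n)"
  unfolding ch_def by (intro continuous_intros)

lemma late_ge: "(1/2)^K \<le> t \<Longrightarrow> K \<le> n \<Longrightarrow> 2 * 2^n * t \<ge> (1::real)"
proof -
  assume t: "(1/2)^K \<le> t" and n: "K \<le> n"
  have "1 \<le> 2 ^ n * (1/2::real)^K"
    using n by (simp add: power_divide power_increasing)
  also have "\<dots> \<le> 2 ^ n * t" using t by (intro mult_left_mono) auto
  finally show ?thesis by simp
qed

section \<open>The explicit flow and its differential equation\<close>

lemma u_eq: "(1/2)^K \<le> t \<Longrightarrow> u (t, x) = (\<Sum>n<K. ch n t *\<^sub>R f n x)"
  unfolding u_def using ch_0[OF disjI2[OF late_ge]] by (subst suminf_finite[of "{..<K}"]) auto

lemma Phi_eq: "(1/2)^K \<le> t \<Longrightarrow> Phi t z = z - (\<Sum>n<K. (1 - th n t) *\<^sub>R f n (P n z))"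
  unfolding Phi_def by (subst suminf_finite[of "{..<K}"]) (auto intro!: th_1 late_ge)

lemma P_eq: "P n z = z - (\<Sum>k<n. f k (P k z))"
  by (induction n) auto

lemma Phi_stage:
  assumes "1 \<le> 4 * 2^n * t" "2 * 2^n * t \<le> 1"
  shows "Phi t z = P n z - (1 - th n t) *\<^sub>R f n (P n z)"
proof -
  have late: "th k t = 1" if "k > n" for k
  proof (rule th_1)
    have "(2::real) ^ Suc n \<le> 2 ^ k" using that by (intro power_increasing) auto
    moreover have "t > 0" using assms(1) by (smt (verit) mult_nonneg_nonpos zero_le_power)
    ultimately have "2 * 2 ^ Suc n * t \<le> 2 * 2 ^ k * t" by simp
    then have "4 * 2 ^ n * t \<le> 2 * 2 ^ k * t" by simp
    then show "1 \<le> 2 * 2 ^ k * t" using assms(1) by linarith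
  qed
  have early: "th k t = 0" if "k < n" for k
  proof (rule th_0)
    have "(2::real) ^ Suc k \<le> 2 ^ n" using that by (intro power_increasing) auto
    moreover have "t > 0" using assms(1) by (smt (verit) mult_nonneg_nonpos zero_le_power)
    ultimately have "2 * 2 ^ Suc k * t \<le> 2 * 2 ^ n * t" by simp
    then have "4 * 2 ^ k * t \<le> 2 * 2 ^ n * t" by simp
    then show "4 * 2 ^ k * t \<le> 1" using assms(2) by linarith
  qed
  have "Phi t z = z - (\<Sum>k<Suc n. (1 - th k t) *\<^sub>R f k (P k z))"
    unfolding Phi_def using late by (subst suminf_finite[of "{..<Suc n}"]) auto
  also have "(\<Sum>k<Suc n. (1 - th k t) *\<^sub>R f k (P k z)) = (\<Sum>k<n. f k (P k z)) + (1 - th n t) *\<^sub>R f n (P n z)"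
    using early by simp
  also have "z - \<dots> = P n z - (1 - th n t) *\<^sub>R f n (P n z)"
    using P_eq[of n z] by simp
  finally show ?thesis .
qed

text \<open>\<open>f n\<close> reads coordinate \<open>ax (Suc n)\<close> and moves only coordinate
  \<open>ax n\<close>, so it is constant along its own displacements.\<close>

lemma f_shift: "f n (x - c *\<^sub>R f n y) = f n x"
  using ax_neq[of n] by (simp add: f_def axis_def)

lemma ch_f_Phi: "ch n t *\<^sub>R f n (Phi t z) = ch n t *\<^sub>R f n (P n z)"
proof (cases "4 * 2^n * t \<le> 1 \<or> 2 * 2^n * t \<ge> 1")
  case False
  then have "Phi t z = P n z - (1 - th n t) *\<^sub>R f n (P n z)" by (intro Phi_stage) auto
  then show ?thesis by (simp add: f_shift)
qed (simp add: ch_0)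

lemma Phi_deriv:
  assumes "t > 0"
  shows "((\<lambda>t. Phi t z) has_vector_derivative u (t, Phi t z)) (at t)"
proof -
  obtain K where K: "(1/2)^K < t" using real_arch_pow_inv[OF assms, of "1/2"] by auto
  have "((\<lambda>t. z - (\<Sum>n<K. (1 - th n t) *\<^sub>R f n (P n z))) has_vector_derivative
      0 - (\<Sum>n<K. (1 - th n t) *\<^sub>R 0 + (0 - ch n t) *\<^sub>R f n (P n z))) (at t)"
    by (intro has_vector_derivative_diff has_vector_derivative_sum has_vector_derivative_scaleR
        has_vector_derivative_const DERIV_diff DERIV_const th_deriv)
  also have "0 - (\<Sum>n<K. (1 - th n t) *\<^sub>R 0 + (0 - ch n t) *\<^sub>R f n (P n z)) = (\<Sum>n<K. ch n t *\<^sub>R f n (P n z))"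
    by (simp add: sum_negf)
  also have "\<dots> = u (t, Phi t z)"
    using K by (simp add: u_eq[of K] ch_f_Phi)
  finally show ?thesis
    by (rule has_vector_derivative_transform_within_open[of _ _ _ "{(1/2)^K<..}"])
       (use K in \<open>auto simp: Phi_eq[of K] less_imp_le\<close>)
qed

lemma summable_geo: "summable (\<lambda>n. c * (1/4)^n :: real)" "summable (\<lambda>n. c * (1/2)^n :: real)"
  by (auto intro!: summable_mult summable_geometric)

lemma Phi_summable:
  assumes "\<And>n. \<bar>c n\<bar> \<le> C"
  shows "summable (\<lambda>n. c n *\<^sub>R f n (g n))"
proof (rule summable_comparison_test'[OF summable_geo(1)[of "C * b"]])
  show "norm (c n *\<^sub>R f n (g n)) \<le> C * b * (1/4)^n" for n
    using mult_mono[OF assms[of n] norm_f_le[of n "g n"]] order_trans[OF abs_ge_zero assms[of n]] by simp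
qed

lemma th_Lipschitz: "\<bar>th n t - th n s\<bar> \<le> 8 * 2^n * \<bar>t - s\<bar>"
proof -
  have "\<bar>th n t - th n s\<bar> \<le> 2 * \<bar>(4 * 2^n * t - 1) - (4 * 2^n * s - 1)\<bar>"
    unfolding th_def by (rule sstep_lipschitz)
  also have "(4 * 2^n * t - 1) - (4 * 2^n * s - 1) = 4 * 2^n * (t - s)" by (simp add: algebra_simps)
  finally show ?thesis by (simp add: abs_mult)
qed

text \<open>The time cut-off of stage n costs 2^n, the displacement gains 4^-n, and the sum over
  stages doubles 8b. The bound includes time 0, which gives absolute continuity on the closed
  interval.\<close>

lemma Phi_Lipschitz: "norm (Phi t z - Phi s z) \<le> 16 * real b * \<bar>t - s\<bar>"
proof -
  let ?h = "\<lambda>n. f n (P n z)"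
  have bd: "norm ((th n t - th n s) *\<^sub>R ?h n) \<le> (8 * real b * \<bar>t - s\<bar>) * (1/2)^n" for n
  proof -
    have "norm ((th n t - th n s) *\<^sub>R ?h n) \<le> (8 * 2^n * \<bar>t - s\<bar>) * (b * (1/4)^n)"
      unfolding norm_scaleR by (intro mult_mono th_Lipschitz norm_f_le) auto
    also have "\<dots> = (8 * real b * \<bar>t - s\<bar>) * (2^n * (1/4)^n)" by simp
    also have "(2::real)^n * (1/4)^n = (1/2)^n" by (simp flip: power_mult_distrib)
    finally show ?thesis .
  qed
  have sm: "summable (\<lambda>n. (1 - th n t) *\<^sub>R ?h n)" for t
    by (rule Phi_summable[of _ 1]) (use th_bounds[of _ t] in auto)
  have "Phi t z - Phi s z = (\<Sum>n. (1 - th n s) *\<^sub>R ?h n - (1 - th n t) *\<^sub>R ?h n)"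
    unfolding Phi_def using suminf_diff[OF sm[of s] sm[of t]] by simp
  also have "\<dots> = (\<Sum>n. (th n t - th n s) *\<^sub>R ?h n)"
    by (simp flip: scaleR_diff_left)
  finally have "norm (Phi t z - Phi s z) = norm (\<Sum>n. (th n t - th n s) *\<^sub>R ?h n)" by simp
  also have "\<dots> \<le> (\<Sum>n. (8 * real b * \<bar>t - s\<bar>) * (1/2)^n)"
    by (rule norm_suminf_le[OF bd summable_geo(2)])
  also have "\<dots> = (8 * real b * \<bar>t - s\<bar>) * 2"
    by (subst suminf_mult) (auto simp: suminf_geometric intro!: summable_geometric)
  finally show ?thesis by simp
qed

lemma Phi_0: "(\<lambda>n. P n z) \<longlonglongrightarrow> Phi 0 z"
proof -
  have "summable (\<lambda>n. 1 *\<^sub>R f n (P n z))" by (rule Phi_summable[of _ 1]) auto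
  then have "(\<lambda>n. z - (\<Sum>k<n. f k (P k z))) \<longlonglongrightarrow> z - (\<Sum>n. f n (P n z))"
    by (intro tendsto_diff tendsto_const summable_LIMSEQ) simp
  moreover have "th n 0 = 0" for n by (simp add: th_0)
  ultimately show ?thesis by (simp add: Phi_def flip: P_eq)
qed

lemma integral_curve_Phi:
  assumes "AE t in lborel. t \<in> {0<..<1} \<longrightarrow> u (t, Phi t z) = v (t, Phi t z)"
  shows "integral_curve v (Phi 0 z) (\<lambda>t. Phi t z)"
  unfolding integral_curve_def
proof (intro conjI)
  show "absolutely_continuous_curve (\<lambda>t. Phi t z)"
    by (rule absolutely_continuous_curve_Lipschitz[OF Phi_Lipschitz])
  show "AE t in lborel. t \<in> {0<..<1} \<longrightarrow> ((\<lambda>t. Phi t z) has_vector_derivative v (t, Phi t z)) (at t)"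
    using assms by eventually_elim (use Phi_deriv in \<open>metis greaterThanLessThan_iff\<close>)
qed simp

lemma Phi_grid: "Phi ((1/2)^Suc n) z = P n z"
proof -
  have "2 * 2 ^ n * ((1/2::real) ^ Suc n) = 1" by (simp add: power_divide)
  then show ?thesis by (subst Phi_stage[of n]) (auto simp: th_1)
qed

section \<open>Regularity of the field in space and time\<close>

lemma prof_deriv: "(prof n has_real_derivative prof' n z) (at z)"
proof -
  have "((\<lambda>z. real (Q (Suc n)) * z) has_real_derivative real (Q (Suc n))) (at z)"
    by (auto intro!: derivative_eq_intros)
  from DERIV_chain2[OF digit_deriv this]
  show ?thesis
    unfolding prof_def[abs_def] prof'_def by (intro DERIV_cdivide DERIV_minus)
qed

lemma continuous_prof: "continuous_on A (prof n)"
  using prof_deriv DERIV_continuous_on has_field_derivative_at_within by metis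

lemma continuous_on_prof [continuous_intros]:
  "continuous_on A g \<Longrightarrow> continuous_on A (\<lambda>x. prof n (g x))"
  using continuous_on_compose2[OF continuous_prof[of UNIV n], of A g] by simp

lemma continuous_on_prof' [continuous_intros]:
  "continuous_on A g \<Longrightarrow> continuous_on A (\<lambda>x. prof' n (g x))"
proof -
  assume g: "continuous_on A g"
  have "continuous_on A (\<lambda>x. digit' b (dl (Suc n)) (real (Q (Suc n)) * g x))"
    using continuous_on_compose2[OF continuous_digit'[of UNIV b "dl (Suc n)"], of A "\<lambda>x. real (Q (Suc n)) * g x"]
      continuous_on_mult_left[OF g] by simp
  then show ?thesis
    unfolding prof'_def divide_inverse by (intro continuous_intros)
qed

lemma Q_mult_int:
  assumes "k \<in> \<int>"
  obtains q where "real (Q n) * k = real b * of_int q"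
proof -
  obtain i where i: "k = of_int i" using assms by (auto elim: Ints_cases)
  obtain c where c: "Q n = b * c" using b_dvd_Q[of n] by (auto elim: dvdE)
  have "real (Q n) * k = real b * of_int (int c * i)" by (simp add: i c)
  then show ?thesis using that by blast
qed

lemma digit_Q_periodic:
  assumes "k \<in> \<int>"
  shows "digit b \<delta> (real (Q n) * (z + k)) = digit b \<delta> (real (Q n) * z)"
    and "digit' b \<delta> (real (Q n) * (z + k)) = digit' b \<delta> (real (Q n) * z)"
proof -
  obtain q where q: "real (Q n) * k = real b * of_int q" using Q_mult_int[OF assms] .
  have "b > 0" using b2 by simp
  then show "digit b \<delta> (real (Q n) * (z + k)) = digit b \<delta> (real (Q n) * z)"
    "digit' b \<delta> (real (Q n) * (z + k)) = digit' b \<delta> (real (Q n) * z)"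
    by (simp_all only: distrib_left q digit_periodic digit'_periodic)
qed

definition Df :: "nat \<Rightarrow> real^'d \<Rightarrow> real^'d^'d" where
  "Df n x = (\<chi> i j. if i = ax n \<and> j = ax (Suc n) then prof' n (x $ ax (Suc n)) else 0)"

lemma f_deriv: "(f n has_derivative (\<lambda>h. Df n x *v h)) (at x)"
proof -
  have "((\<lambda>x. x $ ax (Suc n)) has_derivative (\<lambda>h. h $ ax (Suc n))) (at x)"
    by (rule bounded_linear_imp_has_derivative[OF bounded_linear_vec_nth])
  from has_derivative_compose[OF this] prof_deriv[of n "x $ ax (Suc n)"]
  have "((\<lambda>x. prof n (x $ ax (Suc n))) has_derivative (\<lambda>h. prof' n (x $ ax (Suc n)) * h $ ax (Suc n))) (at x)"
    by (simp add: has_field_derivative_def)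
  then have "(f n has_derivative (\<lambda>h. (prof' n (x $ ax (Suc n)) * h $ ax (Suc n)) *\<^sub>R axis (ax n) 1)) (at x)"
    unfolding f_def by (rule has_derivative_scaleR_left)
  moreover have "(prof' n (x $ ax (Suc n)) * h $ ax (Suc n)) *\<^sub>R axis (ax n) 1 = Df n x *v h" for h
    unfolding vec_eq_iff
  proof
    fix i
    have "(Df n x *v h) $ i = (\<Sum>j\<in>UNIV. if j = ax (Suc n) then (if i = ax n then prof' n (x $ ax (Suc n)) * h $ j else 0) else 0)"
      unfolding matrix_vector_mult_def Df_def vec_lambda_beta by (rule sum.cong) auto
    also have "\<dots> = (if i = ax n then prof' n (x $ ax (Suc n)) * h $ ax (Suc n) else 0)" by simp
    finally show "((prof' n (x $ ax (Suc n)) * h $ ax (Suc n)) *\<^sub>R axis (ax n) 1) $ i = (Df n x *v h) $ i"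
      by (simp add: axis_def)
  qed
  ultimately show ?thesis by simp
qed

lemma continuous_f: "continuous_on A (f n)"
  unfolding f_def by (intro continuous_intros)

lemma continuous_on_f [continuous_intros]:
  "continuous_on A g \<Longrightarrow> continuous_on A (\<lambda>x. f n (g x))"
  using continuous_on_compose2[OF continuous_f[of UNIV n], of A g] by simp

lemma continuous_Df: "continuous_on A (Df n)"
proof -
  have "continuous_on A (\<lambda>x. if i = ax n \<and> j = ax (Suc n) then prof' n (x $ ax (Suc n)) else 0)" for i j
    by (cases "i = ax n \<and> j = ax (Suc n)") (auto intro!: continuous_intros)
  then show ?thesis
    unfolding Df_def by (intro continuous_intros)
qed

lemma periodic_f: "periodic (f n)" and periodic_Df: "periodic (Df n)"
  by (auto simp: periodic_def int_lattice_def f_def Df_def prof_def prof'_def digit_Q_periodic vec_eq_iff)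

lemma comb_weak_deriv:
  "is_weak_deriv (\<lambda>x. \<Sum>n<K. c n *\<^sub>R f n x) (\<lambda>x. \<Sum>n<K. c n *\<^sub>R Df n x)"
proof (rule is_weak_deriv_classical)
  fix x
  have "((\<lambda>x. \<Sum>n<K. c n *\<^sub>R f n x) has_derivative (\<lambda>h. \<Sum>n<K. c n *\<^sub>R (Df n x *v h))) (at x)"
    by (intro has_derivative_sum has_derivative_scaleR_right f_deriv)
  moreover have "(\<Sum>n<K. c n *\<^sub>R (Df n x *v h)) = (\<Sum>n<K. c n *\<^sub>R Df n x) *v h" for h
    by (induction K) (simp_all add: matrix_vector_mult_add_rdistrib scaleR_matrix_vector_assoc)
  ultimately show "((\<lambda>x. \<Sum>n<K. c n *\<^sub>R f n x) has_derivative (\<lambda>h. (\<Sum>n<K. c n *\<^sub>R Df n x) *v h)) (at x)"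
    by simp
  show "continuous_on UNIV (\<lambda>x. \<Sum>n<K. c n *\<^sub>R Df n x)"
    by (intro continuous_intros continuous_Df)
  show "periodic (\<lambda>x. \<Sum>n<K. c n *\<^sub>R f n x)" "periodic (\<lambda>x. \<Sum>n<K. c n *\<^sub>R Df n x)"
    using periodic_f periodic_Df by (simp_all add: periodic_def)
qed

lemma comb_Lp:
  assumes "p > 0"
  shows "(\<lambda>x. \<Sum>n<K. c n *\<^sub>R f n x) \<in> Lp p" "(\<lambda>x. \<Sum>n<K. c n *\<^sub>R Df n x) \<in> Lp p"
proof -
  have "periodic (\<lambda>x. \<Sum>n<K. c n *\<^sub>R f n x)" "periodic (\<lambda>x. \<Sum>n<K. c n *\<^sub>R Df n x)"
    using periodic_f periodic_Df by (simp_all add: periodic_def)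
  moreover have "continuous_on UNIV (\<lambda>x. \<Sum>n<K. c n *\<^sub>R f n x)" "continuous_on UNIV (\<lambda>x. \<Sum>n<K. c n *\<^sub>R Df n x)"
    by (intro continuous_intros continuous_Df)+
  ultimately show "(\<lambda>x. \<Sum>n<K. c n *\<^sub>R f n x) \<in> Lp p" "(\<lambda>x. \<Sum>n<K. c n *\<^sub>R Df n x) \<in> Lp p"
    using continuous_periodic_Lp assms by blast+
qed

lemma comb_norm_le:
  assumes "p > 0" and M: "\<And>n x. norm (g n x) \<le> M n" and g: "\<And>n. continuous_on UNIV (g n)"
  shows "Lp_norm p (\<lambda>x::real^'d. \<Sum>n<K. c n *\<^sub>R g n x :: 'b::euclidean_space) \<le> (\<Sum>n<K. \<bar>c n\<bar> * M n)"
proof (rule Lp_norm_le[OF _ _ assms(1)])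
  show "(\<lambda>x. \<Sum>n<K. c n *\<^sub>R g n x) \<in> borel_measurable borel"
    by (intro borel_measurable_continuous_onI continuous_intros g)
  show "norm (\<Sum>n<K. c n *\<^sub>R g n x) \<le> (\<Sum>n<K. \<bar>c n\<bar> * M n)" for x
    by (rule order_trans[OF norm_sum]) (auto intro!: sum_mono mult_left_mono M)
qed

lemma u_LIMSEQ: "(\<lambda>K. \<Sum>n<K. ch n (fst p) *\<^sub>R f n (snd p)) \<longlonglongrightarrow> u p"
proof -
  have "summable (\<lambda>n. ch n (fst p) *\<^sub>R f n (snd p))"
  proof (cases "fst p > 0")
    case True
    then obtain K where K: "(1/2)^K < fst p" using real_arch_pow_inv[OF True, of "1/2"] by auto
    then have "ch n (fst p) = 0" if "n \<notin> {..<K}" for n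
      using that by (intro ch_0 disjI2 late_ge[of K]) auto
    then show ?thesis by (intro summable_finite[of "{..<K}"]) auto
  next
    case False
    then have "4 * 2 ^ n * fst p \<le> 1" for n
    proof -
      have "4 * 2 ^ n * fst p \<le> 0" using False by (intro mult_nonneg_nonpos) auto
      then show ?thesis by linarith
    qed
    then show ?thesis by (simp add: ch_0)
  qed
  then show ?thesis unfolding u_def by (rule summable_LIMSEQ)
qed

lemma measurable_u [measurable]: "u \<in> borel_measurable borel"
proof (rule borel_measurable_LIMSEQ_metric)
  show "(\<lambda>p. \<Sum>n<K. ch n (fst p) *\<^sub>R f n (snd p)) \<in> borel_measurable borel" for K
    using continuous_on_compose2[OF continuous_ch[of UNIV], of UNIV fst]
    by (intro borel_measurable_continuous_onI continuous_intros) (auto simp: continuous_on_fst continuous_on_id)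
qed (rule u_LIMSEQ)

text \<open>One finite sum represents the field at all times near \<open>t\<close>, which reduces
  continuity in time to that of finitely many functions \<open>ch n\<close>.\<close>

lemma u_comb:
  assumes "t > 0"
  obtains K where "\<And>t' x. t / 2 < t' \<Longrightarrow> u (t', x) = (\<Sum>n<K. ch n t' *\<^sub>R f n x)"
proof -
  obtain K where "(1/2)^K < t / 2" using real_arch_pow_inv[of "t / 2" "1/2"] assms by auto
  then have "u (t', x) = (\<Sum>n<K. ch n t' *\<^sub>R f n x)" if "t / 2 < t'" for t' x
    using that by (intro u_eq) linarith
  then show ?thesis by (rule that)
qed

lemma borel_field_u: "borel_field u"
proof -
  have "periodic (\<lambda>x. u (t, x))" if "t \<in> {0<..<1}" for t
  proof -
    obtain K where "\<And>t' x. t / 2 < t' \<Longrightarrow> u (t', x) = (\<Sum>n<K. ch n t' *\<^sub>R f n x)"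
      using u_comb[of t] \<open>t \<in> {0<..<1}\<close> by auto
    then have "u (t, x) = (\<Sum>n<K. ch n t *\<^sub>R f n x)" for x using \<open>t \<in> {0<..<1}\<close> by simp
    then show ?thesis using periodic_f by (simp add: periodic_def)
  qed
  then show ?thesis
    unfolding borel_field_def by (auto intro: measurable_restrict_space1)
qed

lemma divergence_free_u:
  assumes "t > 0"
  shows "divergence_free (\<lambda>x. u (t, x))"
proof -
  obtain K where K: "\<And>t' x. t / 2 < t' \<Longrightarrow> u (t', x) = (\<Sum>n<K. ch n t' *\<^sub>R f n x)"
    using u_comb[OF assms] by blast
  have "divergence_free (\<lambda>x. \<Sum>n<K. ch n t *\<^sub>R f n x)"
  proof (rule is_weak_deriv_divergence_free[OF comb_weak_deriv])
    show "(\<Sum>n<K. ch n t *\<^sub>R Df n x) $ j $ j = 0" for x j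
      using ax_neq by (auto simp: Df_def intro!: sum.neutral)
  qed (intro continuous_intros)
  then show ?thesis using K[of t] assms by simp
qed

lemma u_in_C_W1_Lp:
  assumes "r > 0" "s > 0"
  shows "u \<in> C_W1_Lp r s"
  unfolding C_W1_Lp_def
proof (intro CollectI conjI ballI borel_field_u)
  fix t :: real assume t: "t \<in> {0<..<1}"
  then obtain K where K: "\<And>t' x. t / 2 < t' \<Longrightarrow> u (t', x) = (\<Sum>n<K. ch n t' *\<^sub>R f n x)"
    using u_comb[of t] by auto
  have eq: "(\<lambda>x. u (t, x)) = (\<lambda>x. \<Sum>n<K. ch n t *\<^sub>R f n x)" using K[of t] t by auto
  show "(\<lambda>x. u (t, x)) \<in> W1 r \<inter> Lp s"
    using comb_Lp[OF assms(1), where c="\<lambda>n. ch n t" and K=K] comb_Lp(1)[OF assms(2), where c="\<lambda>n. ch n t" and K=K]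
      comb_weak_deriv[where c="\<lambda>n. ch n t" and K=K]
    unfolding eq W1_def by blast
  have "\<exists>M. \<forall>x. norm (Df n x) \<le> M" for n
    using continuous_periodic_bounded[OF continuous_Df periodic_Df] by metis
  then obtain M where M: "\<And>n x. norm (Df n x) \<le> M n" by metis
  let ?N = "\<lambda>n. b * (1/4)^n :: real"
  let ?B = "\<lambda>t'. (\<Sum>n<K. \<bar>ch n t' - ch n t\<bar> * ?N n) + (\<Sum>n<K. \<bar>ch n t' - ch n t\<bar> * M n)
      + (\<Sum>n<K. \<bar>ch n t' - ch n t\<bar> * ?N n)"
  let ?L = "\<lambda>t'. W1_norm r (\<lambda>x. u (t', x) - u (t, x)) + Lp_norm s (\<lambda>x. u (t', x) - u (t, x))"
  have le: "?L t' \<le> ?B t'" if "t / 2 < t'" for t'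
  proof -
    have d: "(\<lambda>x. u (t', x) - u (t, x)) = (\<lambda>x. \<Sum>n<K. (ch n t' - ch n t) *\<^sub>R f n x)"
      using K[of t] K[of t'] t that by (auto simp: scaleR_diff_left sum_subtractf)
    show ?thesis
      unfolding d W1_norm_def Lp_norm_weak_deriv[OF comb_weak_deriv]
      by (intro add_mono comb_norm_le assms norm_f_le continuous_f M continuous_Df)
  qed
  have "(ch n \<longlongrightarrow> ch n t) (at t within {0<..<1})" for n
    using continuous_ch[of "{0<..<1}" n] t by (simp add: continuous_on_def)
  then have "(?B \<longlongrightarrow> (\<Sum>n<K. \<bar>ch n t - ch n t\<bar> * ?N n) + (\<Sum>n<K. \<bar>ch n t - ch n t\<bar> * M n)
      + (\<Sum>n<K. \<bar>ch n t - ch n t\<bar> * ?N n)) (at t within {0<..<1})"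
    by (intro tendsto_intros)
  then have lim: "(?B \<longlongrightarrow> 0) (at t within {0<..<1})" by simp
  show "(?L \<longlongrightarrow> 0) (at t within {0<..<1})"
  proof (rule tendsto_sandwich[OF _ _ tendsto_const lim])
    show "\<forall>\<^sub>F t' in at t within {0<..<1}. 0 \<le> ?L t'"
      by (intro always_eventually allI add_nonneg_nonneg) (auto simp: W1_norm_def Lp_norm_nonneg)
    have "eventually (\<lambda>t'. t / 2 < t') (at t within {0<..<1})"
      using t by (intro order_tendstoD(1)[OF tendsto_ident_at]) auto
    then show "\<forall>\<^sub>F t' in at t within {0<..<1}. ?L t' \<le> ?B t'"
      by eventually_elim (rule le)
  qed
qed

end

section \<open>Null sets\<close>

lemma countable_int_lattice: "countable (int_lattice :: (real^'d) set)"
proof -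
  have "int_lattice \<subseteq> range (\<lambda>g::'d \<Rightarrow> int. (\<chi> i. of_int (g i)) :: real^'d)"
  proof
    fix k :: "real^'d" assume "k \<in> int_lattice"
    then have "\<forall>i. \<exists>m::int. k $ i = of_int m" by (auto simp: int_lattice_def Ints_def)
    then obtain g where "\<And>i. k $ i = of_int (g i :: int)" by metis
    then have "k = (\<chi> i. of_int (g i))" by (simp add: vec_eq_iff)
    then show "k \<in> range (\<lambda>g::'d \<Rightarrow> int. (\<chi> i. of_int (g i)) :: real^'d)" by blast
  qed
  then show ?thesis by (rule countable_subset) simp
qed

lemma negligible_periodic:
  fixes A :: "(real^'d) set"
  assumes per: "\<And>x k. k \<in> int_lattice \<Longrightarrow> x \<in> A \<Longrightarrow> x + k \<in> A" and null: "negligible (A \<inter> cell)"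
  shows "negligible A"
proof -
  have "A \<subseteq> (\<Union>k\<in>int_lattice. (+) k ` (A \<inter> cell))"
  proof
    fix x assume x: "x \<in> A"
    obtain k where k: "k \<in> int_lattice" "x + k \<in> cell" using ex_cell_translate[of x] by blast
    have "x = - k + (x + k)" by simp
    then show "x \<in> (\<Union>k\<in>int_lattice. (+) k ` (A \<inter> cell))"
      using k per[OF k(1) x] int_lattice_uminus[OF k(1)] by blast
  qed
  moreover have "negligible (\<Union>k\<in>int_lattice. (+) k ` (A \<inter> cell))"
    using null countable_int_lattice by (intro negligible_countable_Union) (auto intro: negligible_translation)
  ultimately show ?thesis using negligible_subset by blast
qed

lemma AE_lborel_iff_negligible:
  "A \<in> sets borel \<Longrightarrow> (AE x in lborel. x \<notin> A) \<longleftrightarrow> negligible A"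
  using AE_iff_null_sets[of A lborel] null_sets_completion_iff[of A lborel]
  by (simp add: negligible_iff_null_sets)

section \<open>The flow at positive times and null sets of space-time\<close>

context branching
begin

lemma P_Suc: "P (Suc n) z = shear (ax n) (ax (Suc n)) (\<lambda>w. - prof n w) (P n z)"
  by (simp add: shear_def f_def)

lemma Phi_stage_shear:
  assumes "1 \<le> 4 * 2^n * t" "2 * 2^n * t \<le> 1"
  shows "Phi t z = shear (ax n) (ax (Suc n)) (\<lambda>w. - (1 - th n t) * prof n w) (P n z)"
  unfolding Phi_stage[OF assms] shear_def f_def
  by (simp only: diff_conv_add_uminus scaleR_scaleR scaleR_minus_left mult_minus_left)

lemma negligible_P_vimage: "negligible W \<Longrightarrow> negligible (P n -` W)"
proof (induction n arbitrary: W)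
  case (Suc n)
  have "P (Suc n) -` W = P n -` (shear (ax n) (ax (Suc n)) (\<lambda>w. - prof n w) -` W)"
    by (auto simp: P_Suc simp del: P.simps)
  then show ?case
    using Suc.IH[OF negligible_shear_vimage[OF DERIV_minus[OF prof_deriv] ax_neq(1) Suc.prems]] by (simp only:)
qed (simp add: vimage_def)

lemma ex_stage:
  assumes "0 < t" "t < 1/2"
  obtains n where "1 \<le> 4 * 2^n * t" "2 * 2^n * t \<le> (1::real)"
proof -
  define n where "n = (LEAST n. 1 \<le> 4 * 2^n * t)"
  obtain K where K: "(1/2)^K < 4 * t" using real_arch_pow_inv[of "4 * t" "1/2"] assms by auto
  then have "2^K * (1/2)^K \<le> 2^K * (4 * t)" by (intro mult_left_mono) auto
  then have "1 \<le> 4 * 2^K * t" by (simp add: power_divide)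
  then have n: "1 \<le> 4 * 2^n * t" unfolding n_def by (rule LeastI)
  moreover have "2 * 2^n * t \<le> 1"
  proof (cases n)
    case (Suc m)
    then have "\<not> 1 \<le> 4 * 2^m * t" using not_less_Least[of m "\<lambda>n. 1 \<le> 4 * 2^n * t"] n_def by auto
    then show ?thesis using Suc by simp
  qed (use assms in simp)
  ultimately show ?thesis by (rule that)
qed

text \<open>At a positive time the flow map is a composition of finitely many shears.\<close>

lemma negligible_Phi_vimage:
  assumes "t > 0" "negligible W"
  shows "negligible (Phi t -` W)"
proof (cases "t < 1/2")
  case True
  then obtain n where n: "1 \<le> 4 * 2^n * t" "2 * 2^n * t \<le> 1" using ex_stage assms(1) by blast
  let ?S = "shear (ax n) (ax (Suc n)) (\<lambda>w. - (1 - th n t) * prof n w)"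
  have "negligible (?S -` W)"
    by (rule negligible_shear_vimage[OF DERIV_cmult[OF prof_deriv] ax_neq(1) assms(2)])
  then have "negligible (P n -` (?S -` W))" by (rule negligible_P_vimage)
  moreover have "P n -` (?S -` W) = Phi t -` W" by (auto simp: Phi_stage_shear[OF n])
  ultimately show ?thesis by simp
next
  case False
  then have "Phi t z = z" for z using Phi_eq[of 1 t z] by (simp add: th_1)
  then show ?thesis using assms by (simp add: vimage_def)
qed

lemma continuous_P: "continuous_on A (P n)"
  by (induction n) (auto intro!: continuous_intros)

lemma measurable_Phi [measurable]: "(\<lambda>p. Phi (fst p) (snd p)) \<in> borel_measurable borel"
proof (rule borel_measurable_LIMSEQ_metric)
  let ?F = "\<lambda>K p. snd p - (\<Sum>n<K. (1 - th n (fst p)) *\<^sub>R f n (P n (snd p)))"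
  have "continuous_on UNIV (th n)" for n
    using th_deriv DERIV_continuous_on has_field_derivative_at_within by metis
  then have "continuous_on UNIV (\<lambda>p::real \<times> (real^'d). th n (fst p))" for n
    using continuous_on_compose2[of UNIV "th n" UNIV fst] by (auto simp: continuous_on_fst continuous_on_id)
  moreover have "continuous_on UNIV (\<lambda>p::real \<times> (real^'d). P n (snd p))" for n
    using continuous_on_compose2[OF continuous_P[of UNIV n], of UNIV snd] by (auto simp: continuous_on_snd continuous_on_id)
  ultimately show "?F K \<in> borel_measurable borel" for K
    by (intro borel_measurable_continuous_onI continuous_intros)
  fix p :: "real \<times> (real^'d)"
  have "\<bar>1 - th n (fst p)\<bar> \<le> 1" for n using th_bounds[of n "fst p"] by auto
  then have "summable (\<lambda>n. (1 - th n (fst p)) *\<^sub>R f n (P n (snd p)))"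
    by (rule Phi_summable)
  then show "(\<lambda>K. ?F K p) \<longlonglongrightarrow> Phi (fst p) (snd p)"
    unfolding Phi_def by (intro tendsto_intros summable_LIMSEQ)
qed

text \<open>The set of disagreement is sliced in time, almost every slice is pulled back along the
  flow to a null set of labels, and the two quantifiers are then exchanged by Fubini, for which the
  joint measurability of \<open>Phi\<close> is needed.\<close>

lemma AE_Phi_agree:
  assumes v: "borel_field v" and ae: "AE p in spacetime_measure. u p = v p"
  shows "AE z in lborel. AE t in lborel. t \<in> {0<..<1} \<longrightarrow> u (t, Phi t z) = v (t, Phi t z)"
proof -
  define W where "W = {p. fst p \<in> {0<..<1} \<and> u p \<noteq> v p}"
  let ?\<Omega> = "{0<..<1::real} \<times> (UNIV :: (real^'d) set)"
  have \<Omega>: "?\<Omega> \<in> sets borel" by (intro borel_open open_Times) auto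
  have [measurable]: "v \<in> borel_measurable (restrict_space borel ?\<Omega>)" using v by (simp add: borel_field_def)
  have [measurable]: "u \<in> borel_measurable (restrict_space borel ?\<Omega>)" by (rule measurable_restrict_space1) measurable
  have "{p \<in> space (restrict_space borel ?\<Omega>). u p \<noteq> v p} \<in> sets (restrict_space borel ?\<Omega>)" by measurable
  moreover have "{p \<in> space (restrict_space borel ?\<Omega>). u p \<noteq> v p} = W"
    by (auto simp: W_def space_restrict_space)
  ultimately have W[measurable]: "W \<in> sets borel"
    using \<Omega> by (simp add: sets_restrict_space_iff)
  have sec: "Pair t -` W \<in> sets borel" for t
    by (rule measurable_sets_borel[of "Pair t" borel]) (auto intro: borel_measurable_continuous_onI continuous_intros)
  have cyl: "({0<..<1} \<times> cell :: (real \<times> (real^'d)) set) \<in> sets borel"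
    unfolding borel_prod[symmetric] by (rule pair_measureI) auto
  have "AE p in lborel. p \<in> {0<..<1} \<times> (cell :: (real^'d) set) \<longrightarrow> u p = v p"
    using ae cyl unfolding spacetime_measure_def by (subst (asm) AE_restrict_space_iff) auto
  then have "AE p in lborel \<Otimes>\<^sub>M lborel. p \<in> {0<..<1} \<times> (cell :: (real^'d) set) \<longrightarrow> u p = v p"
    by (simp only: lborel_prod)
  then have "AE t in lborel. AE x in lborel. (t, x) \<in> {0<..<1} \<times> (cell :: (real^'d) set) \<longrightarrow> u (t, x) = v (t, x)"
    by (rule lborel_pair.AE_pair)
  then have sections: "AE t in lborel. AE z in lborel. t \<in> {0<..<1} \<longrightarrow> u (t, Phi t z) = v (t, Phi t z)"
  proof eventually_elim
    case (elim t)
    show ?case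
    proof (cases "t \<in> {0<..<1}")
      case True
      have mem: "x \<in> Pair t -` W \<longleftrightarrow> u (t, x) \<noteq> v (t, x)" for x using True by (auto simp: W_def)
      have "AE x in lborel. x \<notin> Pair t -` W \<inter> cell"
        using elim by eventually_elim (use True mem in auto)
      then have "negligible (Pair t -` W \<inter> cell)"
        by (subst (asm) AE_lborel_iff_negligible) (auto intro: sec)
      \<comment> \<open>Agreement is given on the cell only, while lifted trajectories leave it;
        periodicity of both fields covers the rest.\<close>
      moreover have "x + k \<in> Pair t -` W" if "k \<in> int_lattice" "x \<in> Pair t -` W" for x k
        using that True v borel_field_u unfolding mem borel_field_def periodic_def by auto
      ultimately have "negligible (Pair t -` W)" using negligible_periodic by blast
      then have "negligible (Phi t -` (Pair t -` W))" using True by (intro negligible_Phi_vimage) auto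
      moreover have "Phi t -` (Pair t -` W) \<in> sets borel"
      proof -
        have "(\<lambda>z. Phi (fst (t, z)) (snd (t, z))) \<in> borel_measurable borel"
          by (rule measurable_compose[OF _ measurable_Phi])
             (auto intro: borel_measurable_continuous_onI continuous_intros)
        then show ?thesis using sec by (intro measurable_sets_borel) auto
      qed
      ultimately have "AE z in lborel. z \<notin> Phi t -` (Pair t -` W)"
        by (subst AE_lborel_iff_negligible)
      then show ?thesis by eventually_elim (use mem in auto)
    qed auto
  qed
  have meas: "{q \<in> space (lborel \<Otimes>\<^sub>M lborel). fst q \<in> {0<..<1} \<longrightarrow>
      u (fst q, Phi (fst q) (snd q)) = v (fst q, Phi (fst q) (snd q))} \<in> sets (lborel \<Otimes>\<^sub>M lborel)"
  proof -
    have "(\<lambda>q. (fst q, Phi (fst q) (snd q))) \<in> borel_measurable (borel :: (real \<times> (real^'d)) measure)"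
      by (intro borel_measurable_Pair measurable_Phi borel_measurable_continuous_onI continuous_intros)
    from measurable_sets_borel[OF this W]
    have "- ((\<lambda>q. (fst q, Phi (fst q) (snd q))) -` W) \<in> sets borel" by simp
    moreover have "{q \<in> space (lborel \<Otimes>\<^sub>M lborel). fst q \<in> {0<..<1} \<longrightarrow>
        u (fst q, Phi (fst q) (snd q)) = v (fst q, Phi (fst q) (snd q))}
      = - ((\<lambda>q. (fst q, Phi (fst q) (snd q))) -` W)"
      by (auto simp: W_def lborel_prod)
    ultimately show ?thesis unfolding lborel_prod by simp
  qed
  show ?thesis
    by (rule iffD1[OF lborel_pair.AE_commute[of "\<lambda>t z. t \<in> {0<..<1} \<longrightarrow> u (t, Phi t z) = v (t, Phi t z)", OF meas] sections])
qed

text \<open>The first n stages run forwards in time: from a position at time 2^-(n+1) to the late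
  position, undoing \<open>P n\<close>.\<close>

fun T :: "nat \<Rightarrow> real^'d \<Rightarrow> real^'d" where
  "T 0 x = x"
| "T (Suc n) x = T n (x + f n x)"

lemma f_add_f: "f n (x + f n x) = f n x"
  using f_shift[of n x "-1" x] by simp

lemma P_T: "P n (T n x) = x"
  by (induction n arbitrary: x) (simp_all add: f_add_f)

lemma continuous_T: "continuous_on A (T n)"
proof -
  have "continuous_on UNIV (T n)"
  proof (induction n)
    case (Suc n)
    have "continuous_on UNIV (\<lambda>x. x + f n x)" by (intro continuous_intros)
    then show ?case using continuous_on_compose2[OF Suc] by simp
  qed simp
  then show ?thesis by (rule continuous_on_subset) simp
qed

lemma emeasure_T_vimage_le: "open U \<Longrightarrow> emeasure lborel (T n -` U) \<le> emeasure lborel U"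
proof (induction n)
  case (Suc n)
  have "open (T n -` U)" using continuous_T[of UNIV n] Suc.prems by (simp add: continuous_on_open_vimage)
  moreover have "T (Suc n) -` U = shear (ax n) (ax (Suc n)) (prof n) -` (T n -` U)"
    by (auto simp: shear_def f_def)
  ultimately have "emeasure lborel (T (Suc n) -` U) \<le> emeasure lborel (T n -` U)"
    using emeasure_shear_vimage_le[OF continuous_prof ax_neq(1)] by simp
  then show ?case using Suc.IH[OF Suc.prems] by (rule order_trans)
qed (simp add: vimage_def)

text \<open>The lower margin is doubled because the position at stage n differs from the limit
  point, apart from a whole number of cells, by later displacements that lower the fractional part
  by up to \<open>dl n\<close>. A margin of \<open>dl n\<close> on both sides is then left for
  \<open>digit_eq\<close>.\<close>

definition Good :: "nat \<Rightarrow> (real^'d) set" where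
  "Good m = {x. \<forall>n\<ge>m. 2 * dl n \<le> frac (real (Q n) * (x $ ax n)) \<and> frac (real (Q n) * (x $ ax n)) \<le> 1 - dl n}"

end

text \<open>Within the cell the condition cuts out at most q slabs, each of thickness (\<beta> -
  \<alpha>) / q.\<close>

lemma measure_frac_slab:
  fixes q :: nat
  assumes "q > 0" "0 \<le> \<alpha>" "\<alpha> \<le> \<beta>" "\<beta> \<le> 1"
  shows "measure torus_measure {x \<in> cell. \<alpha> \<le> frac (real q * (x :: real^'d) $ j) \<and> frac (real q * x $ j) \<le> \<beta>} \<le> \<beta> - \<alpha>"
proof -
  interpret finite_measure "torus_measure :: (real^'d) measure" by (rule finite_torus_measure)
  define lo hi where "lo i = (\<chi> l. if l = j then (real i + \<alpha>) / q else 0 :: real^'d)"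
    and "hi i = (\<chi> l. if l = j then (real i + \<beta>) / q else 1 :: real^'d)" for i :: nat
  have le: "lo i $ l \<le> hi i $ l" for i l
    using assms by (auto simp: lo_def hi_def divide_right_mono)
  have sets: "S \<inter> cell \<in> sets torus_measure" if "S \<in> sets borel" for S :: "(real^'d) set"
    using that by (auto simp: torus_measure_def sets_restrict_space)
  have slab: "measure torus_measure (cbox (lo i) (hi i) \<inter> cell) \<le> (\<beta> - \<alpha>) / q" for i
  proof -
    have "measure torus_measure (cbox (lo i) (hi i) \<inter> cell) = measure lborel (cbox (lo i) (hi i) \<inter> cell)"
      unfolding torus_measure_def by (subst measure_restrict_space) auto
    also have "\<dots> \<le> measure lborel (cbox (lo i) (hi i))"
      by (rule measure_mono_fmeasurable) (auto intro: fmeasurable_cbox)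
    also have "\<dots> = (\<Prod>l\<in>UNIV. hi i $ l - lo i $ l)"
      by (subst content_cbox_cart) (use le in \<open>auto simp: interval_ne_empty_cart\<close>)
    also have "\<dots> = (\<Prod>l\<in>UNIV. if l = j then (\<beta> - \<alpha>) / q else 1)"
      by (intro prod.cong) (auto simp: lo_def hi_def diff_divide_distrib add_divide_distrib)
    also have "\<dots> = (\<beta> - \<alpha>) / q" by simp
    finally show ?thesis .
  qed
  have sub: "{x \<in> cell. \<alpha> \<le> frac (real q * x $ j) \<and> frac (real q * x $ j) \<le> \<beta>}
      \<subseteq> (\<Union>i<q. cbox (lo i) (hi i) \<inter> cell)"
  proof
    fix x assume x: "x \<in> {x \<in> cell. \<alpha> \<le> frac (real q * x $ j) \<and> frac (real q * x $ j) \<le> \<beta>}"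
    define i where "i = nat \<lfloor>real q * x $ j\<rfloor>"
    have xj: "0 \<le> x $ j" "x $ j < 1" using x by (auto simp: cell_def)
    then have "0 \<le> real q * x $ j" "real q * x $ j < real q" using assms(1) by auto
    then have i: "i < q" "real i = of_int \<lfloor>real q * x $ j\<rfloor>"
      unfolding i_def by (auto simp: nat_less_iff floor_less_iff)
    have "real i + \<alpha> \<le> real q * x $ j" "real q * x $ j \<le> real i + \<beta>"
      using x i by (auto simp: frac_def)
    then have "(real i + \<alpha>) / q \<le> x $ j" "x $ j \<le> (real i + \<beta>) / q"
      using assms(1) by (auto simp: field_simps)
    then have "x \<in> cbox (lo i) (hi i)"
      using x by (auto simp: mem_box_cart lo_def hi_def cell_def less_imp_le)
    then show "x \<in> (\<Union>i<q. cbox (lo i) (hi i) \<inter> cell)" using i x by auto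
  qed
  have "measure torus_measure {x \<in> cell. \<alpha> \<le> frac (real q * (x :: real^'d) $ j) \<and> frac (real q * x $ j) \<le> \<beta>}
      \<le> measure torus_measure (\<Union>i<q. cbox (lo i) (hi i) \<inter> cell)"
    by (rule finite_measure_mono[OF sub]) (auto intro!: sets.finite_UN sets)
  also have "\<dots> \<le> (\<Sum>i<q. measure torus_measure (cbox (lo i) (hi i) \<inter> cell))"
    by (rule finite_measure_subadditive_finite) (auto intro!: sets)
  also have "\<dots> \<le> (\<Sum>i<q. (\<beta> - \<alpha>) / q)" by (intro sum_mono slab)
  also have "\<dots> = \<beta> - \<alpha>" using assms(1) by simp
  finally show ?thesis .
qed

context branching
begin

lemma dl_bounds: "0 < dl n" "dl n \<le> 1/8"
  using power_decreasing[of 3 "n + 3" "1/2::real"] by (auto simp: dl_def power3_eq_cube)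

lemma AE_Good: "AE x in torus_measure. \<exists>m. x \<in> Good m"
proof -
  interpret finite_measure "torus_measure :: (real^'d) measure" by (rule finite_torus_measure)
  let ?fr = "\<lambda>n x. frac (real (Q n) * (x :: real^'d) $ ax n)"
  \<comment> \<open>\<open>A\<close> and \<open>A'\<close> are the lower and upper margins of the
    cells of stage n that \<open>Good\<close> excludes.\<close>
  define A where "A n = {x \<in> cell. 0 \<le> ?fr n x \<and> ?fr n x \<le> 2 * dl n}" for n
  define A' where "A' n = {x \<in> cell. 1 - dl n \<le> ?fr n x \<and> ?fr n x \<le> 1}" for n
  have sum: "summable (\<lambda>n. c * dl n)" for c
    unfolding dl_def by (simp add: power_add summable_mult summable_mult2 summable_geometric)
  have frm: "(\<lambda>x. ?fr n x) \<in> borel_measurable borel" for n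
    unfolding frac_def by measurable
  have sets: "{x \<in> cell. \<alpha> \<le> ?fr n x \<and> ?fr n x \<le> \<beta>} \<in> sets torus_measure" for \<alpha> \<beta> n
  proof -
    have "{x \<in> cell. \<alpha> \<le> ?fr n x \<and> ?fr n x \<le> \<beta>} = {x. \<alpha> \<le> ?fr n x \<and> ?fr n x \<le> \<beta>} \<inter> cell" by auto
    moreover have "{x. \<alpha> \<le> ?fr n x \<and> ?fr n x \<le> \<beta>} \<in> sets borel" using frm by measurable
    ultimately show ?thesis by (auto simp: torus_measure_def sets_restrict_space)
  qed
  have "AE x in torus_measure. eventually (\<lambda>n. x \<in> space torus_measure - A n) sequentially"
  proof (rule borel_cantelli_AE1)
    show "summable (\<lambda>n. measure torus_measure (A n))"
    proof (rule summable_comparison_test'[OF sum[of 2]])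
      fix n
      have "measure torus_measure (A n) \<le> 2 * dl n - 0"
        unfolding A_def using dl_bounds[of n] by (intro measure_frac_slab) auto
      then show "norm (measure torus_measure (A n)) \<le> 2 * dl n" by simp
    qed
  qed (auto simp: A_def emeasure_finite less_top[symmetric] simp del: frac_ge_0 intro!: sets)
  moreover have "AE x in torus_measure. eventually (\<lambda>n. x \<in> space torus_measure - A' n) sequentially"
  proof (rule borel_cantelli_AE1)
    show "summable (\<lambda>n. measure torus_measure (A' n))"
    proof (rule summable_comparison_test'[OF sum[of 1]])
      fix n
      have "measure torus_measure (A' n) \<le> 1 - (1 - dl n)"
        unfolding A'_def using dl_bounds[of n] by (intro measure_frac_slab) auto
      then show "norm (measure torus_measure (A' n)) \<le> 1 * dl n" by simp
    qed
  qed (auto simp: A'_def sets emeasure_finite less_top[symmetric])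
  ultimately show ?thesis
  proof eventually_elim
    case (elim x)
    then have "eventually (\<lambda>n. 2 * dl n \<le> ?fr n x \<and> ?fr n x \<le> 1 - dl n) sequentially"
      by eventually_elim (auto simp: A_def A'_def frac_lt_1 less_imp_le)
    then show ?case unfolding eventually_sequentially Good_def by auto
  qed
qed

end

section \<open>Digits of a good point\<close>

context branching
begin

text \<open>For a label \<open>i\<close>, the digits at the stages \<open>n \<ge> m\<close> of the trajectory that ends up in \<open>x\<close>:
  the shear at stage \<open>n\<close> subtracts digit \<open>n + 1\<close> from digit \<open>n\<close>.\<close>

fun dig :: "real^'d \<Rightarrow> nat \<Rightarrow> nat \<Rightarrow> nat \<Rightarrow> int" where
  "dig x m i 0 = int i"
| "dig x m i (Suc k) = (\<lfloor>real (Q (m + k)) * (x $ ax (m + k))\<rfloor> - dig x m i k) mod int b"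

text \<open>The candidate position at time 2^-(n+1) of a trajectory that tends to \<open>x\<close>,
  given that stage j displaces it by al j / \<open>Q j\<close>. The sequence \<open>al\<close> is
  left open to cover both the full and the truncated displacements.\<close>

definition pos :: "real^'d \<Rightarrow> (nat \<Rightarrow> real) \<Rightarrow> nat \<Rightarrow> real^'d" where
  "pos x al n = x - (\<Sum>j. (al (n + j) / real (Q (n + j))) *\<^sub>R axis (ax (n + j)) 1)"

lemma al_term_bound:
  assumes "0 \<le> al" "al \<le> real b"
  shows "norm ((al / real (Q n)) *\<^sub>R axis (ax n) 1 :: real^'d) \<le> (1/4)^n"
proof -
  have "norm ((al / real (Q n)) *\<^sub>R axis (ax n) 1 :: real^'d) = al / real (Q n)"
    using assms by simp
  also have "\<dots> \<le> real b / (real b * 4 ^ n)"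
    using assms b2 Q_lower[of n] by (intro frac_le) auto
  also have "\<dots> = (1/4)^n" using b2 by (simp add: power_divide)
  finally show ?thesis .
qed

lemma pos_summable:
  assumes "\<And>j. 0 \<le> al j" "\<And>j. al j \<le> real b"
  shows "summable (\<lambda>j. (al (n + j) / real (Q (n + j))) *\<^sub>R (axis (ax (n + j)) 1 :: real^'d))"
proof (rule summable_comparison_test'[OF summable_geo(1)[of 1]])
  fix j
  have "norm ((al (n + j) / real (Q (n + j))) *\<^sub>R (axis (ax (n + j)) 1 :: real^'d)) \<le> (1/4)^(n + j)"
    by (rule al_term_bound) (rule assms)+
  also have "\<dots> \<le> 1 * (1/4)^j" by (simp add: power_decreasing)
  finally show "norm ((al (n + j) / real (Q (n + j))) *\<^sub>R (axis (ax (n + j)) 1 :: real^'d)) \<le> 1 * (1/4)^j" .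
qed

lemma pos_Suc:
  assumes "\<And>j. 0 \<le> al j" "\<And>j. al j \<le> real b"
  shows "pos x al n = pos x al (Suc n) - (al n / real (Q n)) *\<^sub>R axis (ax n) 1"
  unfolding pos_def using suminf_split_head[OF pos_summable[where al=al and n=n, OF assms]] by simp

lemma pos_diff_bound:
  assumes al: "\<And>j. 0 \<le> al j" "\<And>j. al j \<le> real b"
  shows "norm (pos x al n - x) \<le> 2 * (1/4)^n"
proof -
  have "norm (pos x al n - x) = norm (\<Sum>j. (al (n + j) / real (Q (n + j))) *\<^sub>R (axis (ax (n + j)) 1 :: real^'d))"
    by (simp add: pos_def)
  also have "\<dots> \<le> (\<Sum>j. (1/4)^n * (1/4)^j)"
  proof (rule norm_suminf_le[OF _ summable_geo(1)])
    show "norm ((al (n + j) / real (Q (n + j))) *\<^sub>R (axis (ax (n + j)) 1 :: real^'d)) \<le> (1/4)^n * (1/4)^j" for j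
      using al_term_bound[of "al (n + j)" "n + j"] al by (simp add: power_add)
  qed
  also have "\<dots> = (1/4)^n * (4/3)"
    by (subst suminf_mult) (auto simp: suminf_geometric intro!: summable_geometric)
  also have "\<dots> \<le> 2 * (1/4)^n" by simp
  finally show ?thesis .
qed

text \<open>Stage n + 1 moves the other coordinate. After the displacement of stage n itself, only
  stages from n + 2 on contribute, and together they make up \<rho>.\<close>

lemma pos_coord:
  assumes al: "\<And>j. 0 \<le> al j" "\<And>j. al j \<le> real b"
  obtains \<rho> where "0 \<le> \<rho>" "\<rho> \<le> dl n"
    "real (Q n) * (pos x al n $ ax n) = real (Q n) * (x $ ax n) - al n - \<rho>"
proof -
  let ?t = "\<lambda>j. (al (n + j) / real (Q (n + j))) *\<^sub>R (axis (ax (n + j)) 1 :: real^'d)"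
  let ?s = "\<lambda>j. real (Q n) * (?t (j + 2) $ ax n)"
  have sm: "summable ?t" by (rule pos_summable[OF al])
  have sm': "summable (\<lambda>j. ?t j $ ax n)" using sm by (rule summable_vec_nth)
  have sms: "summable ?s" using sm' by (intro summable_mult) (subst summable_iff_shift)
  have s: "0 \<le> ?s j" "?s j \<le> (1/2)^(n + 4) * (1/2)^j" for j
  proof -
    show "0 \<le> ?s j" using al by (auto simp: axis_def)
    have "?s j \<le> real (Q n) * (al (n + (j + 2)) / real (Q (n + (j + 2))))"
      using al by (intro mult_left_mono) (auto simp: axis_def)
    also have "\<dots> \<le> real (Q n) * (real b / (real b * 2 ^ (n + (j + 2) + 2) * real (Q n)))"
      using al b2 Q_growth[of n "n + (j + 2)"] by (intro mult_left_mono frac_le) auto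
    also have "\<dots> = (1/2)^(n + (j + 2) + 2)" using b2 by (simp add: power_divide)
    also have "\<dots> = (1/2)^(n + 4) * (1/2)^j"
      unfolding power_add[symmetric] by (rule arg_cong[where f="power (1/2)"]) simp
    finally show "?s j \<le> (1/2)^(n + 4) * (1/2)^j" .
  qed
  define \<rho> where "\<rho> = (\<Sum>j. ?s j)"
  have "0 \<le> \<rho>" unfolding \<rho>_def by (intro suminf_nonneg sms s)
  moreover have "\<rho> \<le> dl n"
  proof -
    have "\<rho> \<le> (\<Sum>j. (1/2)^(n + 4) * (1/2)^j)"
      unfolding \<rho>_def by (intro suminf_le s sms summable_geo)
    also have "\<dots> = (1/2)^(n + 4) * 2"
      by (subst suminf_mult) (auto simp: suminf_geometric intro!: summable_geometric)
    also have "\<dots> = dl n" by (simp add: dl_def power_add power4_eq_xxxx power3_eq_cube)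
    finally show ?thesis .
  qed
  moreover have "real (Q n) * (pos x al n $ ax n) = real (Q n) * (x $ ax n) - al n - \<rho>"
  proof -
    have "(\<Sum>j. ?t j) $ ax n = (\<Sum>j. ?t j $ ax n)"
      by (rule bounded_linear.suminf[OF bounded_linear_vec_nth sm])
    also have "\<dots> = (\<Sum>j. ?t (j + 2) $ ax n) + (\<Sum>j<2. ?t j $ ax n)"
      by (rule suminf_split_initial_segment[OF sm'])
    also have "(\<Sum>j<2. ?t j $ ax n) = al n / real (Q n)"
      using ax_neq[of n] by (simp add: numeral_2_eq_2 axis_def)
    also have "(\<Sum>j. ?t (j + 2) $ ax n) = \<rho> / real (Q n)"
    proof -
      have "\<rho> = real (Q n) * (\<Sum>j. ?t (j + 2) $ ax n)"
        unfolding \<rho>_def using sm' by (intro suminf_mult) (subst summable_iff_shift)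
      then show ?thesis by simp
    qed
    finally have "(\<Sum>j. ?t j) $ ax n = \<rho> / real (Q n) + al n / real (Q n)" .
    then show ?thesis by (simp add: pos_def algebra_simps)
  qed
  ultimately show ?thesis by (rule that)
qed

lemma dig_bounds: "i < b \<Longrightarrow> 0 \<le> dig x m i k \<and> dig x m i k < int b"
  by (cases k) auto

text \<open>Compared with \<open>x\<close>, the scaled coordinate is lowered by a whole number of
  cells, the next digit, and by \<rho>, which the margins of \<open>Good\<close> absorb. Its floor
  is therefore the floor at \<open>x\<close> minus the next digit, and by the recursion for
  \<open>dig\<close> this is the current digit modulo b. The smoothed digit function thus reads
  exactly the prescribed value.\<close>

lemma digit_pos:
  assumes al: "\<And>j. 0 \<le> al j" "\<And>j. al j \<le> real b"
    and x: "x \<in> Good m" and i: "i < b" and al_eq: "al (m + k) = of_int (dig x m i (Suc k))"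
  shows "digit b (dl (m + k)) (real (Q (m + k)) * (pos x al (m + k) $ ax (m + k))) = of_int (dig x m i k)"
proof -
  let ?n = "m + k"
  let ?z = "real (Q ?n) * (x $ ax ?n)"
  obtain \<rho> where \<rho>: "0 \<le> \<rho>" "\<rho> \<le> dl ?n"
    "real (Q ?n) * (pos x al ?n $ ax ?n) = ?z - al ?n - \<rho>"
    by (rule pos_coord[where al=al and x=x and n="m + k", OF al])
  have fr: "2 * dl ?n \<le> frac ?z" "frac ?z \<le> 1 - dl ?n" using x by (auto simp: Good_def)
  let ?y = "?z - of_int (dig x m i (Suc k)) - \<rho>"
  have fl: "\<lfloor>?y\<rfloor> = \<lfloor>?z\<rfloor> - dig x m i (Suc k)"
    using fr \<rho> dl_bounds[of ?n] by (intro floor_unique) (auto simp: frac_def)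
  then have fry: "frac ?y = frac ?z - \<rho>" by (simp add: frac_def)
  have "digit b (dl ?n) ?y = of_int (\<lfloor>?y\<rfloor> mod int b)"
  proof (rule digit_eq[OF b2 dl_bounds(1)])
    show "dl ?n < 1/2" using dl_bounds(2)[of ?n] by linarith
    show "dl ?n \<le> frac ?y" "frac ?y \<le> 1 - dl ?n" unfolding fry using fr \<rho> by linarith+
  qed
  also have "\<lfloor>?y\<rfloor> mod int b = dig x m i k mod int b"
    unfolding fl by (simp add: mod_diff_right_eq)
  also have "dig x m i k mod int b = dig x m i k"
    using dig_bounds[OF i, of x m k] by simp
  finally show ?thesis using \<rho>(3) al_eq by simp
qed

text \<open>The shear at stage m + k reads the digit of stage m + k + 1. For that digit to be
  correct the displacement of stage m + k + 1 must be prescribed too, hence two conditions on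
  \<open>al\<close>.\<close>

lemma shear_pos:
  assumes al: "\<And>j. 0 \<le> al j" "\<And>j. al j \<le> real b" and x: "x \<in> Good m" and i: "i < b"
    and al_eq: "al (m + k) = of_int (dig x m i (Suc k))" "al (m + Suc k) = of_int (dig x m i (Suc (Suc k)))"
  shows "pos x al (Suc (m + k)) + f (m + k) (pos x al (Suc (m + k))) = pos x al (m + k)"
proof -
  have "f (m + k) (pos x al (Suc (m + k))) = - (al (m + k) / real (Q (m + k))) *\<^sub>R axis (ax (m + k)) 1"
    using digit_pos[where al=al and k="Suc k", OF al x i al_eq(2)] al_eq(1) by (simp add: f_def prof_def)
  then show ?thesis using pos_Suc[where al=al and x=x and n="m + k", OF al] by simp
qed

text \<open>The displacement at stage j is digit j + 1, hence the index
  \<open>Suc (j - m)\<close>.\<close>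

definition full :: "real^'d \<Rightarrow> nat \<Rightarrow> nat \<Rightarrow> nat \<Rightarrow> real" where
  "full x m i j = (if m \<le> j then of_int (dig x m i (Suc (j - m))) else 0)"

definition trunc :: "real^'d \<Rightarrow> nat \<Rightarrow> nat \<Rightarrow> nat \<Rightarrow> nat \<Rightarrow> real" where
  "trunc x m i k j = (if j < m + k then full x m i j else 0)"

text \<open>The i-th inverse branch of the limit map at \<open>x\<close>, as a late position: the
  stages from \<open>m\<close> on are encoded in digits, and the finitely many earlier ones are run
  forwards by \<open>T m\<close>.\<close>

definition start :: "real^'d \<Rightarrow> nat \<Rightarrow> nat \<Rightarrow> real^'d" where
  "start x m i = T m (pos x (full x m i) m)"

lemma full_bounds: "i < b \<Longrightarrow> 0 \<le> full x m i j" "i < b \<Longrightarrow> full x m i j \<le> real b"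
proof -
  assume "i < b"
  from dig_bounds[OF this, of x m "Suc (j - m)"]
  have "0 \<le> dig x m i (Suc (j - m))" "dig x m i (Suc (j - m)) \<le> int b" by auto
  then have "0 \<le> real_of_int (dig x m i (Suc (j - m)))" "real_of_int (dig x m i (Suc (j - m))) \<le> real_of_int (int b)"
    by (simp_all only: of_int_0_le_iff of_int_le_iff)
  then show "0 \<le> full x m i j" "full x m i j \<le> real b"
    by (simp_all only: full_def of_int_of_nat_eq split: if_splits) auto
qed

lemma trunc_bounds: "i < b \<Longrightarrow> 0 \<le> trunc x m i k j" "i < b \<Longrightarrow> trunc x m i k j \<le> real b"
  by (simp_all add: trunc_def full_bounds)

lemma T_pos_full:
  assumes x: "x \<in> Good m" and i: "i < b"
  shows "T (m + k) (pos x (full x m i) (m + k)) = start x m i"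
proof (induction k)
  case (Suc k)
  have "pos x (full x m i) (Suc (m + k)) + f (m + k) (pos x (full x m i) (Suc (m + k))) = pos x (full x m i) (m + k)"
    by (rule shear_pos[OF full_bounds[OF i] x i]) (simp_all add: full_def)
  then show ?case using Suc by simp
qed (simp add: start_def)

lemma P_start:
  assumes "x \<in> Good m" "i < b"
  shows "P (m + k) (start x m i) = pos x (full x m i) (m + k)"
  using T_pos_full[OF assms, of k] P_T by metis

lemma Phi_start:
  assumes "x \<in> Good m" "i < b"
  shows "Phi 0 (start x m i) = x"
proof (rule LIMSEQ_unique)
  show "(\<lambda>k. P (k + m) (start x m i)) \<longlonglongrightarrow> Phi 0 (start x m i)"
    by (rule LIMSEQ_ignore_initial_segment[OF Phi_0])
  have "(\<lambda>k. pos x (full x m i) (m + k) - x) \<longlonglongrightarrow> 0"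
  proof (rule Lim_null_comparison)
    have "norm (pos x (full x m i) (m + k) - x) \<le> 2 * (1/4)^(m + k)" for k
      by (rule pos_diff_bound[OF full_bounds[OF assms(2)]])
    then show "\<forall>\<^sub>F k in sequentially. norm (pos x (full x m i) (m + k) - x) \<le> 2 * (1/4)^(m + k)"
      by (intro always_eventually allI)
    have "(\<lambda>k. 2 * (1/4)^(m + k) :: real) \<longlonglongrightarrow> 2 * 0"
      unfolding add.commute[of m] by (intro tendsto_mult tendsto_const LIMSEQ_ignore_initial_segment LIMSEQ_realpow_zero) auto
    then show "(\<lambda>k. 2 * (1/4)^(m + k) :: real) \<longlonglongrightarrow> 0" by simp
  qed
  then have "(\<lambda>k. pos x (full x m i) (m + k)) \<longlonglongrightarrow> x" by (rule LIM_zero_cancel)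
  then show "(\<lambda>k. P (k + m) (start x m i)) \<longlonglongrightarrow> x"
    unfolding P_start[OF assms, symmetric] by (simp only: add.commute[of m])
qed

text \<open>Up to stage m + K the truncated displacements agree with the full ones, so the shears
  still match. The induction step looks one stage ahead, whence the bound on
  \<open>k\<close>.\<close>

lemma T_pos_trunc:
  assumes x: "x \<in> Good m" and i: "i < b" and "k \<le> K"
  shows "T (m + k) (pos x (trunc x m i (Suc K)) (m + k)) = T m (pos x (trunc x m i (Suc K)) m)"
  using assms(3)
proof (induction k)
  case (Suc k)
  have "pos x (trunc x m i (Suc K)) (Suc (m + k)) + f (m + k) (pos x (trunc x m i (Suc K)) (Suc (m + k)))
      = pos x (trunc x m i (Suc K)) (m + k)"
    by (rule shear_pos[OF trunc_bounds[OF i] x i]) (use Suc.prems in \<open>simp_all add: trunc_def full_def\<close>)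
  then show ?case using Suc by simp
qed simp

text \<open>A single displacement is left, with only b possible values. For fixed K the dependence
  on \<open>x\<close> is thereby reduced to b translations.\<close>

lemma pos_trunc_end:
  "pos x (trunc x m i (Suc K)) (m + K)
    = x - (of_int (dig x m i (Suc K)) / real (Q (m + K))) *\<^sub>R axis (ax (m + K)) 1"
proof -
  have "(\<Sum>j. (trunc x m i (Suc K) (m + K + j) / real (Q (m + K + j))) *\<^sub>R (axis (ax (m + K + j)) 1 :: real^'d))
     = (\<Sum>j\<in>{0}. (trunc x m i (Suc K) (m + K + j) / real (Q (m + K + j))) *\<^sub>R axis (ax (m + K + j)) 1)"
    by (rule suminf_finite) (auto simp: trunc_def)
  then show ?thesis by (simp add: pos_def trunc_def full_def)
qed

lemma pos_trunc_lim:
  assumes i: "i < b"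
  shows "(\<lambda>K. pos x (trunc x m i (Suc K)) m) \<longlonglongrightarrow> pos x (full x m i) m"
proof -
  \<comment> \<open>The first K displacements of both sequences coincide, so the positions differ
    only by their tails, which \<open>pos_diff_bound\<close> controls.\<close>
  have eq: "pos x al m = x - (\<Sum>j<k. (al (m + j) / real (Q (m + j))) *\<^sub>R axis (ax (m + j)) 1) + (pos x al (m + k) - x)"
    if al: "\<And>j. 0 \<le> al j" "\<And>j. al j \<le> real b" for al k
    using suminf_split_initial_segment[OF pos_summable[where al=al and n=m, OF al], of k]
    by (simp add: pos_def ac_simps)
  have "(\<lambda>K. pos x (trunc x m i (Suc K)) m - pos x (full x m i) m) \<longlonglongrightarrow> 0"
  proof (rule Lim_null_comparison)
    have "norm (pos x (trunc x m i (Suc K)) m - pos x (full x m i) m) \<le> 4 * (1/4)^K" for K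
    proof -
      have "pos x (trunc x m i (Suc K)) m - pos x (full x m i) m
          = (pos x (trunc x m i (Suc K)) (m + K) - x) - (pos x (full x m i) (m + K) - x)"
        using eq[of "trunc x m i (Suc K)" K, OF trunc_bounds[OF i]]
          eq[of "full x m i" K, OF full_bounds[OF i]]
        by (simp add: trunc_def)
      also have "norm \<dots> \<le> norm (pos x (trunc x m i (Suc K)) (m + K) - x) + norm (pos x (full x m i) (m + K) - x)"
        by (rule norm_triangle_ineq4)
      also have "\<dots> \<le> 2 * (1/4)^(m + K) + 2 * (1/4)^(m + K)"
        by (rule add_mono[OF pos_diff_bound[where al="trunc x m i (Suc K)", OF trunc_bounds[OF i]]
              pos_diff_bound[where al="full x m i", OF full_bounds[OF i]]])
      also have "\<dots> \<le> 4 * (1/4)^K" by (simp add: power_decreasing)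
      finally show ?thesis .
    qed
    then show "\<forall>\<^sub>F K in sequentially. norm (pos x (trunc x m i (Suc K)) m - pos x (full x m i) m) \<le> 4 * (1/4)^K"
      by (intro always_eventually allI)
    have "(\<lambda>K. 4 * (1/4)^K :: real) \<longlonglongrightarrow> 4 * 0"
      by (intro tendsto_mult tendsto_const LIMSEQ_realpow_zero) auto
    then show "(\<lambda>K. 4 * (1/4)^K :: real) \<longlonglongrightarrow> 0" by simp
  qed
  then show ?thesis by (rule LIM_zero_cancel)
qed

text \<open>At stage \<open>m\<close> the digit of the i-th branch is the label \<open>i\<close>
  itself, and the digit function is invariant under lattice translations, so it separates the
  branches on the torus.\<close>

lemma start_distinct:
  assumes x: "x \<in> Good m" and i: "i < b" and j: "j < b" and eq: "torus_eq (P m (start x m i)) (P m (start x m j))"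
  shows "i = j"
proof -
  have dg: "digit b (dl m) (real (Q m) * (P m (start x m i) $ ax m)) = real i" if "i < b" for i
    using digit_pos[where k=0 and al="full x m i", OF full_bounds[OF that] x that] P_start[OF x that, of 0] by (simp add: full_def)
  have "P m (start x m i) $ ax m - P m (start x m j) $ ax m \<in> \<int>"
    using eq by (auto simp: torus_eq_def int_lattice_def)
  from digit_Q_periodic(1)[OF this, of "dl m" m "P m (start x m j) $ ax m"]
  show ?thesis using dg[OF i] dg[OF j] by simp
qed

section \<open>Null sets under the inverse branches\<close>

definition Hits :: "nat \<Rightarrow> (real^'d) set \<Rightarrow> nat \<Rightarrow> (real^'d) set" where
  "Hits n U l = {x. T n (x - (real l / real (Q n)) *\<^sub>R axis (ax n) 1) \<in> U}"

lemma open_Hits: "open U \<Longrightarrow> open (Hits n U l)"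
proof -
  assume U: "open U"
  have "continuous_on UNIV (\<lambda>x. T n (x - (real l / real (Q n)) *\<^sub>R axis (ax n) 1))"
    by (rule continuous_on_compose2[OF continuous_T[of UNIV n]]) (auto intro!: continuous_intros)
  then show ?thesis
    using U by (simp add: Hits_def continuous_on_open_vimage vimage_def)
qed

lemma emeasure_Hits: "open U \<Longrightarrow> emeasure lborel (Hits n U l) \<le> emeasure lborel U"
proof -
  assume U: "open U"
  let ?v = "- ((real l / real (Q n)) *\<^sub>R axis (ax n) 1) :: real^'d"
  have o: "open (T n -` U)" using continuous_T[of UNIV n] U by (simp add: continuous_on_open_vimage)
  have "Hits n U l = (+) ?v -` (T n -` U)" by (auto simp: Hits_def)
  also have "emeasure lborel \<dots> = emeasure (distr lborel borel ((+) ?v)) (T n -` U)"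
    using o by (subst emeasure_distr) auto
  also have "\<dots> = emeasure lborel (T n -` U)" by (simp add: lborel_distr_plus)
  also have "\<dots> \<le> emeasure lborel U" by (rule emeasure_T_vimage_le[OF U])
  finally show ?thesis .
qed

text \<open>Replacing the digits beyond stage \<open>m + K\<close> by zero changes the starting point only slightly, and
  it leaves \<open>x\<close> up to one of \<open>b\<close> translations as an image under the measure preserving flow.\<close>

lemma start_in_open:
  assumes x: "x \<in> Good m" and i: "i < b" and U: "open U" "start x m i \<in> U"
  shows "eventually (\<lambda>K. x \<in> (\<Union>l<b. Hits (m + K) U l)) sequentially"
proof -
  have "isCont (T m) (pos x (full x m i) m)" using continuous_T[of UNIV m] by (simp add: continuous_on_eq_continuous_at)
  from isCont_tendsto_compose[OF this pos_trunc_lim[OF i]]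
  have "eventually (\<lambda>K. T m (pos x (trunc x m i (Suc K)) m) \<in> U) sequentially"
    using U topological_tendstoD unfolding start_def by blast
  then show ?thesis
  proof eventually_elim
    case (elim K)
    let ?l = "nat (dig x m i (Suc K))"
    have l: "?l < b" "real ?l = of_int (dig x m i (Suc K))"
      using dig_bounds[OF i, of x m "Suc K"] by (auto simp del: dig.simps)
    have "T (m + K) (x - (real ?l / real (Q (m + K))) *\<^sub>R axis (ax (m + K)) 1) \<in> U"
      using elim T_pos_trunc[OF x i order_refl[of K]] pos_trunc_end[of x m i K] l by simp
    then show ?case using l(1) unfolding Hits_def by blast
  qed
qed

text \<open>Each point of the set lies in \<open>W K\<close> for all large K, and every
  \<open>W K\<close> has measure at most \<epsilon>; the lower limit \<open>V\<close> of these sets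
  inherits the bound.\<close>

lemma negligible_start_in:
  assumes Z: "negligible Z"
  shows "negligible {x \<in> Good m. \<exists>i<b. start x m i \<in> Z}"
proof -
  let ?E = "{x \<in> Good m. \<exists>i<b. start x m i \<in> Z}"
  have "\<exists>V. ?E \<subseteq> V \<and> V \<in> lmeasurable \<and> measure lebesgue V \<le> \<epsilon>" if \<epsilon>: "\<epsilon> > 0" for \<epsilon>
  proof -
    have Zl: "Z \<in> sets lebesgue" "emeasure lebesgue Z = 0"
      using Z by (auto simp: negligible_iff_null_sets null_sets_def)
    \<comment> \<open>Division by \<open>b\<close> compensates for the union over the b values of
      the last displacement.\<close>
    obtain U where U: "open U" "Z \<subseteq> U" "U - Z \<in> lmeasurable" "emeasure lebesgue (U - Z) < ennreal (\<epsilon> / b)"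
      using sets_lebesgue_outer_open[OF Zl(1), of "\<epsilon> / b"] \<epsilon> b2 by auto
    have "emeasure lebesgue U \<le> emeasure lebesgue (Z \<union> (U - Z))"
      using U Zl by (intro emeasure_mono) auto
    also have "\<dots> \<le> emeasure lebesgue Z + emeasure lebesgue (U - Z)"
      using U Zl by (intro emeasure_subadditive) auto
    finally have Ue: "emeasure lborel U \<le> ennreal (\<epsilon> / b)" using U Zl by simp
    define W where "W K = (\<Union>l<b. Hits (m + K) U l)" for K
    have Wb[measurable]: "W K \<in> sets borel" for K
      unfolding W_def by (intro borel_open open_UN) (auto intro: open_Hits U)
    have We: "emeasure lborel (W K) \<le> ennreal \<epsilon>" for K
    proof -
      have "emeasure lborel (W K) \<le> (\<Sum>l<b. emeasure lborel (Hits (m + K) U l))"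
        unfolding W_def by (intro emeasure_subadditive_finite) (auto intro!: borel_open open_Hits U)
      also have "\<dots> \<le> (\<Sum>l<b. ennreal (\<epsilon> / b))"
        by (intro sum_mono order_trans[OF emeasure_Hits[OF U(1)] Ue])
      also have "\<dots> = ennreal \<epsilon>"
        using b2 \<epsilon> by (simp add: ennreal_of_nat_eq_real_of_nat ennreal_mult'[symmetric])
      finally show ?thesis .
    qed
    define V where "V = (\<Union>L. \<Inter>K\<in>{L..}. W K)"
    have Vb[measurable]: "V \<in> sets borel" unfolding V_def by measurable
    have "emeasure lborel V = (SUP L. emeasure lborel (\<Inter>K\<in>{L..}. W K))"
      unfolding V_def by (rule SUP_emeasure_incseq[symmetric]) (auto simp: incseq_def)
    also have "\<dots> \<le> ennreal \<epsilon>"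
    proof (rule SUP_least)
      fix L
      have "emeasure lborel (\<Inter>K\<in>{L..}. W K) \<le> emeasure lborel (W L)"
        by (rule emeasure_mono) auto
      then show "emeasure lborel (\<Inter>K\<in>{L..}. W K) \<le> ennreal \<epsilon>" using We order_trans by blast
    qed
    finally have Ve: "emeasure lebesgue V \<le> ennreal \<epsilon>" by simp
    have "V \<in> lmeasurable" using Ve by (intro fmeasurableI) (auto intro: le_less_trans)
    moreover have "measure lebesgue V \<le> \<epsilon>" using Ve \<epsilon> by (simp add: measure_def enn2real_leI)
    moreover have "?E \<subseteq> V"
    proof
      fix x assume "x \<in> ?E"
      then obtain i where "x \<in> Good m" "i < b" "start x m i \<in> U" using U(2) by auto
      from start_in_open[OF this(1,2) U(1) this(3)]
      show "x \<in> V" unfolding V_def W_def eventually_sequentially by auto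
    qed
    ultimately show ?thesis by blast
  qed
  then show ?thesis using negligible_outer_le by blast
qed

lemma AE_curves:
  assumes v: "borel_field v" and ae: "AE p in spacetime_measure. u p = v p"
  shows "AE x in torus_measure. at_least_integral_curves b v x"
proof -
  define good where "good z \<longleftrightarrow> (AE t in lborel. t \<in> {0<..<1} \<longrightarrow> u (t, Phi t z) = v (t, Phi t z))" for z
  have "AE z in lborel. good z" unfolding good_def by (rule AE_Phi_agree[OF v ae])
  then have "AE z in lebesgue. good z" by (rule AE_completion)
  then obtain M where "M \<in> null_sets lebesgue" "{z. \<not> good z} \<subseteq> M"
    by (auto simp: eventually_ae_filter)
  then have Z: "negligible {z. \<not> good z}"
    using negligible_subset negligible_iff_null_sets by blast
  let ?E = "\<Union>m. {x \<in> Good m. \<exists>i<b. start x m i \<in> {z. \<not> good z}}"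
  have "negligible ?E" by (rule negligible_Union_nat) (rule negligible_start_in[OF Z])
  then have "AE x in lebesgue. x \<notin> ?E"
    by (intro AE_not_in) (simp add: negligible_iff_null_sets)
  then have "AE x in lborel. x \<notin> ?E" by (simp only: AE_completion_iff)
  then have "AE x in torus_measure. x \<notin> ?E" by (auto simp: AE_torus_measure_iff elim: eventually_mono)
  with AE_Good show ?thesis
  proof eventually_elim
    case (elim x)
    then obtain m where m: "x \<in> Good m" by blast
    then have good: "good (start x m i)" if "i < b" for i using elim(2) that by blast
    have "integral_curve v x (\<lambda>t. Phi t (start x m i))" if "i < b" for i
      using integral_curve_Phi[of "start x m i" v] good[OF that] Phi_start[OF m that] by (simp add: good_def)
    moreover have "\<exists>t\<in>{0..1}. \<not> torus_eq (Phi t (start x m i)) (Phi t (start x m j))"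
      if "i < b" "j < b" "i \<noteq> j" for i j
    \<comment> \<open>At this time the position is \<open>P m\<close> of the starting label, where
      digit \<open>m\<close> still shows which branch was chosen.\<close>
    proof (intro bexI[of _ "(1/2)^Suc m"])
      show "\<not> torus_eq (Phi ((1/2)^Suc m) (start x m i)) (Phi ((1/2)^Suc m) (start x m j))"
        using start_distinct[OF m that(1,2)] that(3) by (auto simp only: Phi_grid)
      show "(1/2)^Suc m \<in> {0..1::real}" by (auto intro: power_le_one simp del: power_Suc)
    qed
    ultimately show ?case
      unfolding at_least_integral_curves_def
      by (intro exI[of _ "\<lambda>i t. Phi t (start x m i)"] conjI allI impI)
  qed
qed

end

theorem theorem1p3:
  fixes N :: nat and r s :: real
  assumes "CARD('d::finite) \<ge> 2" and "1 \<le> r" and "r < real CARD('d)" and "0 < s"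
  shows "\<exists>u :: real \<times> (real ^ 'd) \<Rightarrow> real ^ 'd.
           u \<in> C_W1_Lp r s \<and>
           (\<forall>t\<in>{0<..<1}. divergence_free (\<lambda>x. u (t, x))) \<and>
           (\<forall>v. borel_field v \<longrightarrow> (AE p in spacetime_measure. u p = v p) \<longrightarrow>
                (AE x in torus_measure. at_least_integral_curves N v x))"
proof -
  obtain e0 e1 :: 'd where "e0 \<noteq> e1"
    using assms(1) card_2_iff' by (metis (full_types) UNIV_I card_le_Suc0_iff_eq finite not_less_eq_eq numeral_2_eq_2)
  \<comment> \<open>A base of at least 2 is required for digits even when N is smaller; surplus
    curves are discarded afterwards by \<open>le\<close>.\<close>
  then interpret branching "max N 2" e0 e1 by unfold_locales auto
  have le: "at_least_integral_curves N v x" if "at_least_integral_curves (max N 2) v x" for v and x :: "real^'d"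
  proof -
    have less: "i < max N 2" if "i < N" for i using that by simp
    obtain \<Gamma> where \<Gamma>: "\<And>i. i < max N 2 \<Longrightarrow> integral_curve v x (\<Gamma> i)"
      "\<And>i j. i < max N 2 \<Longrightarrow> j < max N 2 \<Longrightarrow> i \<noteq> j \<Longrightarrow> \<exists>t\<in>{0..1}. \<not> torus_eq (\<Gamma> i t) (\<Gamma> j t)"
      using \<open>at_least_integral_curves (max N 2) v x\<close> unfolding at_least_integral_curves_def by metis
    then show ?thesis
      unfolding at_least_integral_curves_def by (intro exI[of _ \<Gamma>] conjI allI impI \<Gamma> less)
  qed
  show ?thesis
  proof (intro exI[of _ u] conjI ballI allI impI)
    show "u \<in> C_W1_Lp r s" using assms by (intro u_in_C_W1_Lp) auto
    show "divergence_free (\<lambda>x. u (t, x))" if "t \<in> {0<..<1}" for t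
      using that by (intro divergence_free_u) auto
    fix v assume "borel_field v" "AE p in spacetime_measure. u p = v p"
    from AE_curves[OF this] show "AE x in torus_measure. at_least_integral_curves N v x"
      by eventually_elim (rule le)
  qed
qed

end
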